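(* Let $G$ be a finite group. Then $\mathrm{ZL}^1(G)$ has a unique diagonal, and \[ \mathrm{am}(\mathrm{ZL}^1(G))=\frac{1}{|G|^2}\sum_{C,C'\in\mathrm{Conj}(G)}\Big|\sum_{\pi\in\widehat G}d_\pi^2\,\overline{\chi_\pi(C)}\,\chi_\pi(C')\Big|\,|C|\,|C'|. \]
   Context: $G$ is given normalised Haar measure $\int_G f=\frac{1}{|G|}\sum_{s\in G}f(s)$; $\mathrm{L}^1(G)$ is the corresponding convolution algebra with norm $\|f\|_1=\frac1{|G|}\sum|f(s)|$ and $\mathrm{ZL}^1(G)$ its centre. $\mathrm{Conj}(G)$ is the set of conjugacy classes; $\widehat G$ the irreducible representations, $d_\pi$ the dimension, $\chi_\pi$ the character, and $\chi_\pi(C)$ its value on the class $C$. A diagonal for a unital Banach algebra $\mathfrak{A}$ is an element $\mu\in\mathfrak{A}\hat\otimes\mathfrak{A}$ with $a\cdot\mu=\mu\cdot a$ for all $a$ and $m(\mu)=1$, where $m$ is multiplication, $a\cdot(b\otimes c)=ab\otimes c$, $(b\otimes c)\cdot a=b\otimes ca$. The amenability constant $\mathrm{am}(\mathfrak{A})$ is the infimum of $\sup_\alpha\|\mu_\alpha\|$ over bounded approximate diagonals $(\mu_\alpha)$ (bounded nets in $\mathfrak{A}\hat\otimes\mathfrak{A}$ with $m(\mu_\alpha)a\to a$, $a\,m(\mu_\alpha)\to a$, $a\cdot\mu_\alpha-\mu_\alpha\cdot a\to0$). *)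

theory Defs
  imports Complex_Main "HOL-Algebra.Group" "Jordan_Normal_Form.Matrix"
begin

definition conj_class :: "('a, 'b) monoid_scheme \<Rightarrow> 'a \<Rightarrow> 'a set" where
  "conj_class G x = {g \<otimes>\<^bsub>G\<^esub> x \<otimes>\<^bsub>G\<^esub> inv\<^bsub>G\<^esub> g | g. g \<in> carrier G}"

definition Conj :: "('a, 'b) monoid_scheme \<Rightarrow> 'a set set" where
  "Conj G = conj_class G ` carrier G"

definition L1 :: "('a, 'b) monoid_scheme \<Rightarrow> ('a \<Rightarrow> complex) set" where
  "L1 G = {f. \<forall>s. s \<notin> carrier G \<longrightarrow> f s = 0}"

text \<open>Convolution w.r.t. normalised Haar measure: (f*g)(s) = 1/|G| sum_t f(t) g(t^-1 s).\<close>
definition conv :: "('a, 'b) monoid_scheme \<Rightarrow> ('a \<Rightarrow> complex) \<Rightarrow> ('a \<Rightarrow> complex) \<Rightarrow> ('a \<Rightarrow> complex)" where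
  "conv G f g = (\<lambda>s. if s \<in> carrier G then
      (\<Sum>t\<in>carrier G. f t * g (inv\<^bsub>G\<^esub> t \<otimes>\<^bsub>G\<^esub> s)) / of_nat (card (carrier G)) else 0)"

definition L1_norm :: "('a, 'b) monoid_scheme \<Rightarrow> ('a \<Rightarrow> complex) \<Rightarrow> real" where
  "L1_norm G f = (\<Sum>s\<in>carrier G. cmod (f s)) / real (card (carrier G))"

definition L1_unit :: "('a, 'b) monoid_scheme \<Rightarrow> ('a \<Rightarrow> complex)" where
  "L1_unit G = (\<lambda>s. if s = \<one>\<^bsub>G\<^esub> then of_nat (card (carrier G)) else 0)"

definition ZL1 :: "('a, 'b) monoid_scheme \<Rightarrow> ('a \<Rightarrow> complex) set" where
  "ZL1 G = {f \<in> L1 G. \<forall>g \<in> L1 G. conv G f g = conv G g f}"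

text \<open>Since ZL1(G) is finite-dimensional, its algebraic tensor square is complete and is
  identified with the span of the elementary tensors a (x) b = (s,t) |-> a s * b t inside the
  functions on G x G.\<close>
definition tensor :: "('a \<Rightarrow> complex) \<Rightarrow> ('a \<Rightarrow> complex) \<Rightarrow> ('a \<times> 'a \<Rightarrow> complex)" where
  "tensor a b = (\<lambda>(s, t). a s * b t)"

definition tensor_reps :: "('a \<Rightarrow> complex) set \<Rightarrow> ('a \<times> 'a \<Rightarrow> complex)
     \<Rightarrow> (nat \<times> (nat \<Rightarrow> 'a \<Rightarrow> complex) \<times> (nat \<Rightarrow> 'a \<Rightarrow> complex)) set" where
  "tensor_reps A u = {(n, a, b). (\<forall>i<n. a i \<in> A \<and> b i \<in> A) \<and> u = (\<lambda>p. \<Sum>i<n. tensor (a i) (b i) p)}"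

definition ZL1_tensor :: "('a, 'b) monoid_scheme \<Rightarrow> ('a \<times> 'a \<Rightarrow> complex) set" where
  "ZL1_tensor G = {u. tensor_reps (ZL1 G) u \<noteq> {}}"

definition proj_norm :: "('a, 'b) monoid_scheme \<Rightarrow> ('a \<times> 'a \<Rightarrow> complex) \<Rightarrow> real" where
  "proj_norm G u = Inf {(\<Sum>i<n. L1_norm G (a i) * L1_norm G (b i)) | n a b.
                          (n, a, b) \<in> tensor_reps (ZL1 G) u}"

text \<open>Bimodule actions: a.(b (x) c) = ab (x) c and (b (x) c).a = b (x) ca, extended linearly.\<close>
definition lact :: "('a, 'b) monoid_scheme \<Rightarrow> ('a \<Rightarrow> complex) \<Rightarrow> ('a \<times> 'a \<Rightarrow> complex) \<Rightarrow> ('a \<times> 'a \<Rightarrow> complex)" where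
  "lact G a u = (\<lambda>(s, t). conv G a (\<lambda>x. u (x, t)) s)"

definition ract :: "('a, 'b) monoid_scheme \<Rightarrow> ('a \<times> 'a \<Rightarrow> complex) \<Rightarrow> ('a \<Rightarrow> complex) \<Rightarrow> ('a \<times> 'a \<Rightarrow> complex)" where
  "ract G u a = (\<lambda>(s, t). conv G (\<lambda>y. u (s, y)) a t)"

text \<open>Multiplication map m : ZL1 (x) ZL1 -> ZL1, m(b (x) c) = b * c, extended linearly.\<close>
definition mult_map :: "('a, 'b) monoid_scheme \<Rightarrow> ('a \<times> 'a \<Rightarrow> complex) \<Rightarrow> ('a \<Rightarrow> complex)" where
  "mult_map G u = (\<lambda>s. if s \<in> carrier G then
      (\<Sum>t\<in>carrier G. u (t, inv\<^bsub>G\<^esub> t \<otimes>\<^bsub>G\<^esub> s)) / of_nat (card (carrier G)) else 0)"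

definition is_diagonal :: "('a, 'b) monoid_scheme \<Rightarrow> ('a \<times> 'a \<Rightarrow> complex) \<Rightarrow> bool" where
  "is_diagonal G \<mu> \<longleftrightarrow> \<mu> \<in> ZL1_tensor G \<and> (\<forall>a\<in>ZL1 G. lact G a \<mu> = ract G \<mu> a)
      \<and> mult_map G \<mu> = L1_unit G"

text \<open>A bounded approximate diagonal, given as a net: a family \<mu> indexed by 'i together with the
  (proper) filter F of tails of the net, i.e. convergence along F is convergence of the net.\<close>
definition is_bdd_approx_diagonal :: "('a, 'b) monoid_scheme \<Rightarrow> ('i \<Rightarrow> ('a \<times> 'a \<Rightarrow> complex))
     \<Rightarrow> 'i filter \<Rightarrow> bool" where
  "is_bdd_approx_diagonal G \<mu> F \<longleftrightarrow> F \<noteq> bot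
     \<and> (\<forall>i. \<mu> i \<in> ZL1_tensor G)
     \<and> bdd_above (range (\<lambda>i. proj_norm G (\<mu> i)))
     \<and> (\<forall>a\<in>ZL1 G. ((\<lambda>i. L1_norm G (\<lambda>s. conv G (mult_map G (\<mu> i)) a s - a s)) \<longlongrightarrow> 0) F)
     \<and> (\<forall>a\<in>ZL1 G. ((\<lambda>i. L1_norm G (\<lambda>s. conv G a (mult_map G (\<mu> i)) s - a s)) \<longlongrightarrow> 0) F)
     \<and> (\<forall>a\<in>ZL1 G. ((\<lambda>i. proj_norm G (\<lambda>p. lact G a (\<mu> i) p - ract G (\<mu> i) a p)) \<longlongrightarrow> 0) F)"

definition am_ZL1 :: "'i itself \<Rightarrow> ('a, 'b) monoid_scheme \<Rightarrow> real" where
  "am_ZL1 (_ :: 'i itself) G = Inf {(SUP i. proj_norm G (\<mu> i)) | (\<mu> :: 'i \<Rightarrow> _) F.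
                                 is_bdd_approx_diagonal G \<mu> F}"

definition is_rep :: "('a, 'b) monoid_scheme \<Rightarrow> nat \<Rightarrow> ('a \<Rightarrow> complex mat) \<Rightarrow> bool" where
  "is_rep G d \<rho> \<longleftrightarrow> (\<forall>g\<in>carrier G. \<rho> g \<in> carrier_mat d d)
     \<and> (\<forall>g\<in>carrier G. \<forall>h\<in>carrier G. \<rho> (g \<otimes>\<^bsub>G\<^esub> h) = \<rho> g * \<rho> h)
     \<and> \<rho> \<one>\<^bsub>G\<^esub> = 1\<^sub>m d"

definition invariant_subspace :: "('a, 'b) monoid_scheme \<Rightarrow> nat \<Rightarrow> ('a \<Rightarrow> complex mat)
     \<Rightarrow> complex vec set \<Rightarrow> bool" where
  "invariant_subspace G d \<rho> W \<longleftrightarrow> W \<subseteq> carrier_vec d \<and> 0\<^sub>v d \<in> W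
     \<and> (\<forall>v\<in>W. \<forall>w\<in>W. v + w \<in> W) \<and> (\<forall>c. \<forall>v\<in>W. c \<cdot>\<^sub>v v \<in> W)
     \<and> (\<forall>g\<in>carrier G. \<forall>v\<in>W. \<rho> g *\<^sub>v v \<in> W)"

definition is_irrep :: "('a, 'b) monoid_scheme \<Rightarrow> nat \<Rightarrow> ('a \<Rightarrow> complex mat) \<Rightarrow> bool" where
  "is_irrep G d \<rho> \<longleftrightarrow> d > 0 \<and> is_rep G d \<rho>
     \<and> (\<forall>W. invariant_subspace G d \<rho> W \<longrightarrow> W = {0\<^sub>v d} \<or> W = carrier_vec d)"

definition rep_equiv :: "('a, 'b) monoid_scheme \<Rightarrow> ((nat \<times> ('a \<Rightarrow> complex mat)) \<times> (nat \<times> ('a \<Rightarrow> complex mat))) set" where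
  "rep_equiv G = {((d, \<rho>), (d', \<rho>')). is_irrep G d \<rho> \<and> is_irrep G d' \<rho>' \<and> d = d'
      \<and> (\<exists>P \<in> carrier_mat d d. invertible_mat P \<and> (\<forall>g\<in>carrier G. P * \<rho> g = \<rho>' g * P))}"

definition dual :: "('a, 'b) monoid_scheme \<Rightarrow> (nat \<times> ('a \<Rightarrow> complex mat)) set set" where
  "dual G = {(d, \<rho>). is_irrep G d \<rho>} // rep_equiv G"

definition dim_of :: "(nat \<times> ('a \<Rightarrow> complex mat)) set \<Rightarrow> nat" where
  "dim_of \<pi> = fst (SOME p. p \<in> \<pi>)"

definition mat_trace :: "complex mat \<Rightarrow> complex" where
  "mat_trace A = (\<Sum>i<dim_row A. A $$ (i, i))"

definition character :: "(nat \<times> ('a \<Rightarrow> complex mat)) set \<Rightarrow> 'a \<Rightarrow> complex" where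
  "character \<pi> g = mat_trace (snd (SOME p. p \<in> \<pi>) g)"

definition character_class :: "(nat \<times> ('a \<Rightarrow> complex mat)) set \<Rightarrow> 'a set \<Rightarrow> complex" where
  "character_class \<pi> C = character \<pi> (SOME g. g \<in> C)"

end

(* Idea: the irreducible characters give orthogonal central idempotents e_pi = d_pi chi_pi of L1(G)
   whose sum is the unit: by Schur orthogonality they are orthogonal, and a function annihilated by
   all of them is annihilated by the regular character, which is a sum of irreducible ones and equals
   the unit. Hence mu = sum_pi e_pi (x) e_pi is a diagonal. For every u in ZL1 (x) ZL1 both
     sum_pi e_pi . u . e_pi = m(u) . mu   and   sum_pi u . e_pi . e_pi = u
   hold, because ZL1(G) acts on each e_pi by scalars. So an element that (almost) commutes with the
   e_pi is (almost) m(u) . mu, which gives uniqueness of mu and the pointwise convergence of every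
   approximate diagonal to mu. The projective norm on ZL1 (x) ZL1 is the L1 norm on G x G, so
   am(ZL1(G)) is the L1 norm of mu; replacing s by its inverse conjugates the first character. *)
theory Submission
  imports Defs "Jordan_Normal_Form.Spectral_Radius"
begin

section \<open>Schur's lemma\<close>

text \<open>The weight d_pi is forced by the normalised Haar measure: orthogonality of matrix
  entries gives chi_pi * chi_pi = chi_pi / d_pi. The same normalisation gives the unit the value |G|
  at 1, which is exactly the trace of the regular representation. That trace is decomposed through
  block triangular matrices: it sees only the diagonal blocks, so an invariant subspace and the
  corresponding quotient already split it. Scalars arise because sum_t f(t) rho(t^-1) commutes with
  rho when f is central. The two sums over pi differ only in the side from which one e_pi acts, so u
  - m(u) . mu is a sum of commutators of u with the e_pi, acted on once more by e_pi. As everything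
  is finite-dimensional, norm convergence is pointwise convergence and the L1 norm is continuous for
  it; the constant net at mu attains the infimum. Representations are arbitrary complex matrices
  rather than unitary ones, so chi(s^-1) = conj(chi(s)) has to come from an averaged Hermitian
  form.\<close>

lemma eq_mat_by_mult_vec:
  fixes A B :: "'a::semiring_1 mat"
  assumes A: "A \<in> carrier_mat n m" and B: "B \<in> carrier_mat n m"
    and eq: "\<And>v. v \<in> carrier_vec m \<Longrightarrow> A *\<^sub>v v = B *\<^sub>v v"
  shows "A = B"
proof (rule eq_matI)
  fix i j assume ij: "i < dim_row B" "j < dim_col B"
  have "(A *\<^sub>v unit_vec m j) $ i = (B *\<^sub>v unit_vec m j) $ i" using eq by simp
  then show "A $$ (i,j) = B $$ (i,j)" using ij A B by (simp add: scalar_prod_right_unit)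
qed (use A B in auto)

lemma invertible_matD:
  assumes "invertible_mat P" "P \<in> carrier_mat n n"
  obtains Q where "Q \<in> carrier_mat n n" "P * Q = 1\<^sub>m n" "Q * P = 1\<^sub>m n"
proof -
  from assms obtain Q where Q: "P * Q = 1\<^sub>m n" "Q * P = 1\<^sub>m (dim_row Q)"
    by (auto simp: invertible_mat_def inverts_mat_def)
  have "dim_col Q = n" using arg_cong[OF Q(1), of dim_col] by simp
  moreover have "dim_row Q = n" using arg_cong[OF Q(2), of dim_col] assms by simp
  ultimately show thesis using that Q by auto
qed

lemma invertible_matI:
  assumes "P \<in> carrier_mat n n" "Q \<in> carrier_mat n n" "P * Q = 1\<^sub>m n" "Q * P = 1\<^sub>m n"
  shows "invertible_mat P"
  using assms by (auto simp: invertible_mat_def inverts_mat_def intro!: exI[of _ Q])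

lemma invertible_mat_if_kernel_trivial:
  fixes A :: "'a::field mat"
  assumes A: "A \<in> carrier_mat n n"
    and ker: "\<And>v. v \<in> carrier_vec n \<Longrightarrow> A *\<^sub>v v = 0\<^sub>v n \<Longrightarrow> v = 0\<^sub>v n"
  shows "invertible_mat A"
proof -
  have "det A \<noteq> 0" using det_0_iff_vec_prod_zero_field[OF A] ker by blast
  from det_non_zero_imp_unit[OF A this, where b = "()"] show ?thesis
    by (auto simp: Units_def ring_mat_def intro: invertible_matI[OF A])
qed

lemma mat_trace_comm:
  assumes A: "A \<in> carrier_mat n m" and B: "B \<in> carrier_mat m n"
  shows "mat_trace (A * B) = mat_trace (B * A)"
proof -
  have "mat_trace (A * B) = (\<Sum>i<n. \<Sum>j<m. A $$ (i,j) * B $$ (j,i))"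
    unfolding mat_trace_def using A B by (intro sum.cong) (auto simp: scalar_prod_def atLeast0LessThan)
  also have "\<dots> = (\<Sum>j<m. \<Sum>i<n. B $$ (j,i) * A $$ (i,j))"
    by (subst sum.swap) (simp add: mult.commute)
  also have "\<dots> = mat_trace (B * A)"
    unfolding mat_trace_def using A B by (intro sum.cong) (auto simp: scalar_prod_def atLeast0LessThan)
  finally show ?thesis .
qed

lemma mat_trace_one [simp]: "mat_trace (1\<^sub>m n) = of_nat n"
  by (simp add: mat_trace_def)

text \<open>Preimages of the unit vectors form the columns of a right inverse \<open>Y\<close>, and
  injectivity makes it a left inverse. Then \<open>X * Y\<close> and \<open>Y * X\<close> are
  identity matrices of sizes e and d with the same trace, so d = e in characteristic 0; this
  replaces a dimension argument.\<close>

lemma bijective_mat_square: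
  fixes X :: "complex mat"
  assumes X: "X \<in> carrier_mat e d"
    and inj: "\<And>v. v \<in> carrier_vec d \<Longrightarrow> X *\<^sub>v v = 0\<^sub>v e \<Longrightarrow> v = 0\<^sub>v d"
    and surj: "\<And>w. w \<in> carrier_vec e \<Longrightarrow> \<exists>v\<in>carrier_vec d. X *\<^sub>v v = w"
  shows "d = e" "invertible_mat X"
proof -
  obtain y where y: "\<And>w. w \<in> carrier_vec e \<Longrightarrow> y w \<in> carrier_vec d \<and> X *\<^sub>v y w = w"
    using surj by metis
  define Y where "Y = mat d e (\<lambda>(i,j). y (unit_vec e j) $ i)"
  have Y: "Y \<in> carrier_mat d e" by (simp add: Y_def)
  have col: "col Y j = y (unit_vec e j)" if "j < e" for j
    using y[of "unit_vec e j"] that by (auto simp: Y_def)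
  have XY: "X * Y = 1\<^sub>m e"
  proof (rule eq_matI)
    fix i j assume ij: "i < dim_row (1\<^sub>m e :: complex mat)" "j < dim_col (1\<^sub>m e :: complex mat)"
    then have "(X * Y) $$ (i,j) = (X *\<^sub>v y (unit_vec e j)) $ i"
      using X Y by (simp add: col)
    then show "(X * Y) $$ (i,j) = 1\<^sub>m e $$ (i,j)" using y[of "unit_vec e j"] ij by (auto)
  qed (use X Y in auto)
  have YX: "Y * X = 1\<^sub>m d"
  proof (rule eq_mat_by_mult_vec)
    fix v :: "complex vec" assume v: "v \<in> carrier_vec d"
    let ?w = "(Y * X) *\<^sub>v v"
    have w: "?w \<in> carrier_vec d" using X Y v by auto
    have "X *\<^sub>v ?w = (X * Y) *\<^sub>v (X *\<^sub>v v)"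
      using X Y v by (metis assoc_mult_mat_vec mult_mat_vec_carrier)
    then have "X *\<^sub>v (?w - v) = 0\<^sub>v e"
      using X Y v w by (simp add: XY mult_minus_distrib_mat_vec)
    then have "?w - v = 0\<^sub>v d" using inj[of "?w - v"] v w by auto
    then have "\<And>i. i < d \<Longrightarrow> (?w - v) $ i = 0" by simp
    then show "?w = 1\<^sub>m d *\<^sub>v v" using v w X Y by (intro eq_vecI) auto
  qed (use X Y in auto)
  have "of_nat e = (of_nat d :: complex)"
    using mat_trace_comm[OF X Y] unfolding XY YX by simp
  then show "d = e" by simp
  then show "invertible_mat X" using X Y XY YX by (auto intro: invertible_matI)
qed

section \<open>Intertwiners of irreducible representations\<close>

lemma is_repD:
  assumes "is_rep G d \<rho>"
  shows "g \<in> carrier G \<Longrightarrow> \<rho> g \<in> carrier_mat d d"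
    "g \<in> carrier G \<Longrightarrow> h \<in> carrier G \<Longrightarrow> \<rho> (g \<otimes>\<^bsub>G\<^esub> h) = \<rho> g * \<rho> h"
    "\<rho> \<one>\<^bsub>G\<^esub> = 1\<^sub>m d"
  using assms by (auto simp: is_rep_def)

lemma is_irrepD:
  assumes "is_irrep G d \<rho>"
  shows "d > 0" "is_rep G d \<rho>"
    "invariant_subspace G d \<rho> W \<Longrightarrow> W = {0\<^sub>v d} \<or> W = carrier_vec d"
  using assms by (auto simp: is_irrep_def)

lemma kernel_invariant:
  assumes \<rho>: "is_rep G d \<rho>" and \<sigma>: "is_rep G e \<sigma>" and X: "X \<in> carrier_mat e d"
    and tw: "\<And>g. g \<in> carrier G \<Longrightarrow> X * \<rho> g = \<sigma> g * X"
  shows "invariant_subspace G d \<rho> {v \<in> carrier_vec d. X *\<^sub>v v = 0\<^sub>v e}"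
proof -
  have "X *\<^sub>v (\<rho> g *\<^sub>v v) = 0\<^sub>v e" if g: "g \<in> carrier G" and v: "v \<in> carrier_vec d" "X *\<^sub>v v = 0\<^sub>v e" for g v
  proof -
    have "X *\<^sub>v (\<rho> g *\<^sub>v v) = (\<sigma> g * X) *\<^sub>v v"
      using is_repD(1)[OF \<rho> g] X v by (simp flip: tw[OF g])
    also have "\<dots> = \<sigma> g *\<^sub>v 0\<^sub>v e"
      using is_repD(1)[OF \<sigma> g] X v by simp
    finally show ?thesis using is_repD(1)[OF \<sigma> g] by auto
  qed
  then show ?thesis unfolding invariant_subspace_def using X is_repD(1)[OF \<rho>]
    by (auto simp: mult_add_distrib_mat_vec mult_mat_vec intro!: mult_mat_vec_carrier[of _ d d])
qed

lemma image_invariant: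
  assumes \<rho>: "is_rep G d \<rho>" and \<sigma>: "is_rep G e \<sigma>" and X: "X \<in> carrier_mat e d"
    and tw: "\<And>g. g \<in> carrier G \<Longrightarrow> X * \<rho> g = \<sigma> g * X"
  shows "invariant_subspace G e \<sigma> {X *\<^sub>v v | v. v \<in> carrier_vec d}"
proof -
  have inv: "\<sigma> g *\<^sub>v (X *\<^sub>v v) = X *\<^sub>v (\<rho> g *\<^sub>v v)" if g: "g \<in> carrier G" and v: "v \<in> carrier_vec d" for g v
  proof -
    have "X *\<^sub>v (\<rho> g *\<^sub>v v) = (\<sigma> g * X) *\<^sub>v v"
      using is_repD(1)[OF \<rho> g] X v by (simp flip: tw[OF g])
    also have "\<dots> = \<sigma> g *\<^sub>v (X *\<^sub>v v)"
      using is_repD(1)[OF \<sigma> g] X v by simp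
    finally show ?thesis by simp
  qed
  have "X *\<^sub>v 0\<^sub>v d = 0\<^sub>v e" using X by auto
  then have 0: "\<exists>v. 0\<^sub>v e = X *\<^sub>v v \<and> v \<in> carrier_vec d" by (metis zero_carrier_vec)
  have add: "\<exists>v. X *\<^sub>v u + X *\<^sub>v w = X *\<^sub>v v \<and> v \<in> carrier_vec d" if "u \<in> carrier_vec d" "w \<in> carrier_vec d" for u w
    using that X by (intro exI[of _ "u + w"]) (simp add: mult_add_distrib_mat_vec)
  have sm: "\<exists>v. c \<cdot>\<^sub>v (X *\<^sub>v u) = X *\<^sub>v v \<and> v \<in> carrier_vec d" if "u \<in> carrier_vec d" for u c
    using that X by (intro exI[of _ "c \<cdot>\<^sub>v u"]) (simp add: mult_mat_vec)
  have act: "\<exists>v. \<sigma> g *\<^sub>v (X *\<^sub>v u) = X *\<^sub>v v \<and> v \<in> carrier_vec d" if "u \<in> carrier_vec d" "g \<in> carrier G" for u g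
    using that is_repD(1)[OF \<rho>] by (intro exI[of _ "\<rho> g *\<^sub>v u"]) (auto simp: inv intro!: mult_mat_vec_carrier[of _ d d])
  show ?thesis unfolding invariant_subspace_def using X 0 add sm act by auto
qed

text \<open>Irreducibility of \<open>\<rho>\<close> leaves only the zero kernel and irreducibility
  of \<open>\<sigma>\<close> only the full image, so \<open>X\<close> acts bijectively.\<close>

lemma schur_nonzero_intertwiner:
  assumes \<rho>: "is_irrep G d \<rho>" and \<sigma>: "is_irrep G e \<sigma>" and X: "X \<in> carrier_mat e d"
    and tw: "\<And>g. g \<in> carrier G \<Longrightarrow> X * \<rho> g = \<sigma> g * X"
    and nz: "X \<noteq> 0\<^sub>m e d"
  shows "d = e" "invertible_mat X"
proof -
  note r = is_irrepD(2)[OF \<rho>] and s = is_irrepD(2)[OF \<sigma>]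
  have ex: "\<exists>v\<in>carrier_vec d. X *\<^sub>v v \<noteq> 0\<^sub>v e"
  proof (rule ccontr)
    assume "\<not> ?thesis"
    then have "X = 0\<^sub>m e d" using X by (intro eq_mat_by_mult_vec) auto
    with nz show False by simp
  qed
  have ker: "{v \<in> carrier_vec d. X *\<^sub>v v = 0\<^sub>v e} = {0\<^sub>v d}"
    using is_irrepD(3)[OF \<rho> kernel_invariant[OF r s X tw]] ex by blast
  have "{X *\<^sub>v v | v. v \<in> carrier_vec d} \<noteq> {0\<^sub>v e}" using ex by blast
  then have im: "{X *\<^sub>v v | v. v \<in> carrier_vec d} = carrier_vec e"
    using is_irrepD(3)[OF \<sigma> image_invariant[OF r s X tw]] by blast
  have "\<And>v. v \<in> carrier_vec d \<Longrightarrow> X *\<^sub>v v = 0\<^sub>v e \<Longrightarrow> v = 0\<^sub>v d" using ker by blast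
  moreover have "\<And>w. w \<in> carrier_vec e \<Longrightarrow> \<exists>v\<in>carrier_vec d. X *\<^sub>v v = w" unfolding im[symmetric] by auto
  ultimately show "d = e" "invertible_mat X" using bijective_mat_square[OF X] by blast+
qed

text \<open>An eigenvalue c exists over the complex numbers since d > 0. The matrix
  \<open>X - c \<cdot>\<^sub>m 1\<^sub>m d\<close> is again an intertwiner but kills an eigenvector,
  so it is not invertible and must vanish.\<close>

lemma schur_scalar:
  assumes \<rho>: "is_irrep G d \<rho>" and X: "X \<in> carrier_mat d d"
    and tw: "\<And>g. g \<in> carrier G \<Longrightarrow> X * \<rho> g = \<rho> g * X"
  obtains c where "X = c \<cdot>\<^sub>m 1\<^sub>m d"
proof -
  obtain c v where v: "eigenvector X v c"
    using spectrum_non_empty[OF X is_irrepD(1)[OF \<rho>]] by (auto simp: spectrum_def eigenvalue_def)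
  note r = is_irrepD(2)[OF \<rho>]
  define Y where "Y = X - c \<cdot>\<^sub>m 1\<^sub>m d"
  have Y: "Y \<in> carrier_mat d d" using X by (simp add: Y_def minus_carrier_mat)
  have Yv: "Y *\<^sub>v w = X *\<^sub>v w - c \<cdot>\<^sub>v w" if "w \<in> carrier_vec d" for w
  proof (rule eq_vecI)
    fix i assume i: "i < dim_vec (X *\<^sub>v w - c \<cdot>\<^sub>v w)"
    then have "row Y i = row X i - c \<cdot>\<^sub>v unit_vec d i"
      using X that by (intro eq_vecI) (auto simp: Y_def)
    then show "(Y *\<^sub>v w) $ i = (X *\<^sub>v w - c \<cdot>\<^sub>v w) $ i"
      using X Y that i by (simp add: minus_scalar_prod_distrib[of _ d])
  qed (use X Y that in auto)
  have twY: "Y * \<rho> g = \<rho> g * Y" if g: "g \<in> carrier G" for g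
    using X is_repD(1)[OF r g] unfolding Y_def
    by (simp add: minus_mult_distrib_mat[of _ d d] mult_minus_distrib_mat[of _ d d] tw[OF g] mult_smult_distrib[of _ d d "1\<^sub>m d" d] mult_smult_assoc_mat[of _ d d _ d])
  have "\<not> (Y \<noteq> 0\<^sub>m d d)"
  proof
    assume "Y \<noteq> 0\<^sub>m d d"
    from schur_nonzero_intertwiner(2)[OF \<rho> \<rho> Y twY this]
    obtain Z where Z: "Z \<in> carrier_mat d d" "Z * Y = 1\<^sub>m d" using invertible_matD[OF _ Y] by metis
    have vc: "v \<in> carrier_vec d" "v \<noteq> 0\<^sub>v d" using v X by (auto simp: eigenvector_def)
    have "Y *\<^sub>v v = 0\<^sub>v d" using v X vc by (simp add: Yv eigenvector_def)
    then have "(Z * Y) *\<^sub>v v = Z *\<^sub>v 0\<^sub>v d" using Z(1) Y vc by simp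
    moreover have "Z *\<^sub>v 0\<^sub>v d = 0\<^sub>v d" using Z by (intro eq_vecI) auto
    ultimately have "v = 0\<^sub>v d" using Z vc by simp
    with vc show False by simp
  qed
  then have Y0: "X - c \<cdot>\<^sub>m 1\<^sub>m d = 0\<^sub>m d d" by (simp add: Y_def)
  have "X = c \<cdot>\<^sub>m 1\<^sub>m d"
  proof (rule eq_matI)
    fix i j assume "i < dim_row (c \<cdot>\<^sub>m 1\<^sub>m d)" "j < dim_col (c \<cdot>\<^sub>m 1\<^sub>m d)"
    then show "X $$ (i,j) = (c \<cdot>\<^sub>m 1\<^sub>m d) $$ (i,j)"
      using arg_cong[OF Y0, of "\<lambda>A. A $$ (i,j)"] X by simp
  qed (use X in auto)
  with that show thesis .
qed

section \<open>Decomposition into irreducible representations\<close>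

text \<open>The product is the combination of the columns of \<open>P\<close> with coefficients
  \<open>c\<close>. Only binary sums are known to stay in \<open>W\<close>, so the combination is
  built one coordinate at a time, through the truncations \<open>t k\<close> of
  \<open>c\<close>.\<close>

lemma mult_mat_vec_in_subspace:
  fixes P :: "complex mat"
  assumes P: "P \<in> carrier_mat n d" and c: "c \<in> carrier_vec d"
    and W: "W \<subseteq> carrier_vec n" "0\<^sub>v n \<in> W" "\<And>v w. v \<in> W \<Longrightarrow> w \<in> W \<Longrightarrow> v + w \<in> W" "\<And>a v. v \<in> W \<Longrightarrow> a \<cdot>\<^sub>v v \<in> W"
    and cols: "\<And>j. j < d \<Longrightarrow> col P j \<in> W"
  shows "P *\<^sub>v c \<in> W"
proof -
  define t where "t k = vec d (\<lambda>i. if i < k then c $ i else 0)" for k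
  have "P *\<^sub>v t k \<in> W" if "k \<le> d" for k
    using that
  proof (induction k)
    case 0
    have "P *\<^sub>v t 0 = 0\<^sub>v n" using P by (intro eq_vecI) (auto simp: t_def scalar_prod_def)
    then show ?case using W by simp
  next
    case (Suc k)
    have "t (Suc k) = t k + c $ k \<cdot>\<^sub>v unit_vec d k"
      by (intro eq_vecI) (auto simp: t_def less_Suc_eq unit_vec_def)
    moreover have "P *\<^sub>v (c $ k \<cdot>\<^sub>v unit_vec d k) = c $ k \<cdot>\<^sub>v col P k"
      using P Suc.prems by (intro eq_vecI) (auto simp: scalar_prod_right_unit)
    ultimately have "P *\<^sub>v t (Suc k) = P *\<^sub>v t k + c $ k \<cdot>\<^sub>v col P k"
      using P by (simp add: mult_add_distrib_mat_vec[of _ n d] t_def)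
    then show ?case using Suc cols[of k] W by auto
  qed
  moreover have "t d = c" using c by (intro eq_vecI) (auto simp: t_def)
  ultimately show ?thesis by (metis order_refl)
qed

text \<open>An invertible matrix with as many columns as possible in \<open>W\<close> has a basis of \<open>W\<close> among
  its columns: otherwise a further column could be exchanged for a vector of \<open>W\<close>.\<close>
lemma adapted_basis:
  fixes W :: "complex vec set"
  assumes W: "W \<subseteq> carrier_vec d" "0\<^sub>v d \<in> W" "\<And>v w. v \<in> W \<Longrightarrow> w \<in> W \<Longrightarrow> v + w \<in> W" "\<And>a v. v \<in> W \<Longrightarrow> a \<cdot>\<^sub>v v \<in> W"
    and ne: "W \<noteq> {0\<^sub>v d}" "W \<noteq> carrier_vec d"
  obtains P Q S where "P \<in> carrier_mat d d" "Q \<in> carrier_mat d d" "P * Q = 1\<^sub>m d" "Q * P = 1\<^sub>m d"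
    "S \<subset> {..<d}" "S \<noteq> {}" "\<And>j. j \<in> S \<Longrightarrow> col P j \<in> W"
    "\<And>w i. w \<in> W \<Longrightarrow> i < d \<Longrightarrow> i \<notin> S \<Longrightarrow> (Q *\<^sub>v w) $ i = 0"
proof -
  let ?S = "\<lambda>P. {j. j < d \<and> col P j \<in> W}"
  let ?inv = "\<lambda>P :: complex mat. P \<in> carrier_mat d d \<and> invertible_mat P"
  have one: "?inv (1\<^sub>m d)" by (auto intro: invertible_matI[of _ d "1\<^sub>m d"])
  have "card (?S P) \<le> d" for P
    using card_mono[of "{..<d}" "?S P"] by auto
  then have "\<forall>P. ?inv P \<longrightarrow> card (?S P) < Suc d"
    by (simp add: less_Suc_eq_le)
  from ex_has_greatest_nat[of ?inv, OF one this] obtain P where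
    P: "P \<in> carrier_mat d d" "invertible_mat P" and max: "\<And>P'. ?inv P' \<Longrightarrow> card (?S P') \<le> card (?S P)"
    by auto
  obtain Q where Q: "Q \<in> carrier_mat d d" "P * Q = 1\<^sub>m d" "Q * P = 1\<^sub>m d"
    using invertible_matD[OF P(2,1)] .
  have PQ: "P *\<^sub>v (Q *\<^sub>v v) = v" and QP: "Q *\<^sub>v (P *\<^sub>v v) = v" if "v \<in> carrier_vec d" for v
    using assoc_mult_mat_vec[OF P(1) Q(1) that] assoc_mult_mat_vec[OF Q(1) P(1) that] Q(2,3) that by simp_all
  have supp: "(Q *\<^sub>v w) $ j = 0" if w: "w \<in> W" and j: "j < d" "j \<notin> ?S P" for w j
  proof (rule ccontr)
    define c where "c = Q *\<^sub>v w"
    assume "(Q *\<^sub>v w) $ j \<noteq> 0"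
    then have cj: "c $ j \<noteq> 0" by (simp add: c_def)
    have wc: "w \<in> carrier_vec d" using w W by auto
    then have c: "c \<in> carrier_vec d" and Pc: "P *\<^sub>v c = w" using Q PQ by (auto simp: c_def)
    \<comment> \<open>\<open>E\<close> is the identity with column j replaced by the coordinates of
      w, so \<open>P * E\<close> is \<open>P\<close> with w in column j. Its kernel is trivial
      because the diagonal entry \<open>c $ j\<close> is nonzero: row j forces
      \<open>v $ j = 0\<close>, and then every other row forces \<open>v $ i = 0\<close>.\<close>
    define E where "E = mat d d (\<lambda>(i,l). if l = j then c $ i else if i = l then 1 else 0)"
    have E: "E \<in> carrier_mat d d" by (simp add: E_def)
    have colE: "col E l = (if l = j then c else unit_vec d l)" if "l < d" for l
      using that c by (intro eq_vecI) (auto simp: E_def)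
    have colPE: "col (P * E) l = (if l = j then w else col P l)" if "l < d" for l
    proof (cases "l = j")
      case True
      then show ?thesis using col_mult2[OF P(1) E that] colE[OF that] Pc by simp
    next
      case False
      then have "col (P * E) l = P *\<^sub>v unit_vec d l"
        using col_mult2[OF P(1) E that] colE[OF that] by simp
      also have "\<dots> = col P l"
        using P(1) that by (intro eq_vecI) (auto simp: scalar_prod_right_unit)
      finally show ?thesis using False by simp
    qed
    have Ev: "(E *\<^sub>v v) $ i = (if i = j then v $ j * c $ j else v $ i + v $ j * c $ i)"
      if "v \<in> carrier_vec d" "i < d" for v i
    proof -
      have "(E *\<^sub>v v) $ i = (\<Sum>l\<in>{..<d}. (if l = j then c $ i else if i = l then 1 else 0) * v $ l)"
        using that by (simp add: E_def scalar_prod_def atLeast0LessThan)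
      also have "\<dots> = c $ i * v $ j + (\<Sum>l\<in>{..<d} - {j}. if l = i then v $ l else 0)"
      proof -
        have "(\<Sum>l\<in>{..<d} - {j}. (if l = j then c $ i else if i = l then 1 else 0) * v $ l)
          = (\<Sum>l\<in>{..<d} - {j}. if l = i then v $ l else 0)"
          by (rule sum.cong) auto
        with j(1) show ?thesis
          using sum.remove[of "{..<d}" j "\<lambda>l. (if l = j then c $ i else if i = l then 1 else 0) * v $ l"] by simp
      qed
      also have "\<dots> = (if i = j then v $ j * c $ j else v $ i + v $ j * c $ i)"
        using that by (simp add: sum.delta)
      finally show ?thesis .
    qed
    have "invertible_mat (P * E)"
    proof (rule invertible_mat_if_kernel_trivial)
      fix v assume v: "v \<in> carrier_vec d" "(P * E) *\<^sub>v v = 0\<^sub>v d"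
      have "E *\<^sub>v v = Q *\<^sub>v (P *\<^sub>v (E *\<^sub>v v))" using QP[of "E *\<^sub>v v"] E v(1) by simp
      also have "P *\<^sub>v (E *\<^sub>v v) = 0\<^sub>v d" using v(2) assoc_mult_mat_vec[OF P(1) E v(1)] by simp
      also have "Q *\<^sub>v 0\<^sub>v d = 0\<^sub>v d" using Q(1) by (intro eq_vecI) auto
      finally have Ev0: "\<And>i. i < d \<Longrightarrow> (E *\<^sub>v v) $ i = 0" by simp
      have "v $ j = 0" using Ev[OF v(1), of j] Ev0[of j] j cj by simp
      then have "v $ i = 0" if "i < d" for i using Ev[OF v(1), of i] Ev0[of i] that by (auto split: if_splits)
      then show "v = 0\<^sub>v d" using v by (intro eq_vecI) auto
    qed (use P E in auto)
    then have "card (?S (P * E)) \<le> card (?S P)" using P E by (intro max) auto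
    \<comment> \<open>The exchange leaves all other columns alone and puts column j into
      \<open>W\<close>, contradicting maximality.\<close>
    moreover have "insert j (?S P) \<subseteq> ?S (P * E)" using colPE j w by auto
    then have "card (insert j (?S P)) \<le> card (?S (P * E))" by (intro card_mono) auto
    ultimately show False using j by simp
  qed
  have "?S P \<noteq> {}"
  proof
    assume "?S P = {}"
    then have "w = 0\<^sub>v d" if "w \<in> W" for w
    proof -
      have "Q *\<^sub>v w = 0\<^sub>v d"
      proof (rule eq_vecI)
        fix i assume "i < dim_vec (0\<^sub>v d :: complex vec)"
        then show "(Q *\<^sub>v w) $ i = 0\<^sub>v d $ i"
          using supp[OF that, of i] unfolding \<open>?S P = {}\<close> by simp
      qed (use Q(1) in simp)
      moreover have "P *\<^sub>v 0\<^sub>v d = 0\<^sub>v d" using P(1) by (intro eq_vecI) auto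
      ultimately show ?thesis using PQ[of w] that W(1) by auto
    qed
    then show False using ne(1) W(2) by blast
  qed
  moreover have "?S P \<noteq> {..<d}"
  proof
    assume S: "?S P = {..<d}"
    have "v \<in> W" if v: "v \<in> carrier_vec d" for v
    proof -
      have "Q *\<^sub>v v \<in> carrier_vec d" using Q(1) v by simp
      moreover have "col P j \<in> W" if "j < d" for j using S that by blast
      ultimately have "P *\<^sub>v (Q *\<^sub>v v) \<in> W" using mult_mat_vec_in_subspace[OF P(1) _ W] by blast
      then show ?thesis using PQ[OF v] by simp
    qed
    then show False using ne(2) W(1) by blast
  qed
  ultimately show thesis using supp by (intro that[OF P(1) Q, of "?S P"]) auto
qed

lemma conjugate_rep:
  assumes \<rho>: "is_rep G d \<rho>" and P: "P \<in> carrier_mat d d" and Q: "Q \<in> carrier_mat d d"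
    and PQ: "P * Q = 1\<^sub>m d" and QP: "Q * P = 1\<^sub>m d" and "group G"
  shows "is_rep G d (\<lambda>g. Q * \<rho> g * P)"
    "g \<in> carrier G \<Longrightarrow> mat_trace (Q * \<rho> g * P) = mat_trace (\<rho> g)"
proof -
  interpret group G by fact
  have "Q * (\<rho> g * \<rho> h) * P = Q * \<rho> g * P * (Q * \<rho> h * P)" if "g \<in> carrier G" "h \<in> carrier G" for g h
  proof -
    note rg = is_repD(1)[OF \<rho> that(1)] and rh = is_repD(1)[OF \<rho> that(2)]
    have "Q * \<rho> g * P * (Q * \<rho> h * P) = Q * \<rho> g * (P * Q) * (\<rho> h * P)"
      using P Q rg rh by (simp add: assoc_mult_mat[of _ d d _ d _ d])
    also have "\<dots> = Q * (\<rho> g * \<rho> h) * P"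
      using P Q rg rh PQ by (simp add: assoc_mult_mat[of _ d d _ d _ d])
    finally show ?thesis by simp
  qed
  then show "is_rep G d (\<lambda>g. Q * \<rho> g * P)"
    using P Q QP \<rho> by (auto simp: is_rep_def)
  show "mat_trace (Q * \<rho> g * P) = mat_trace (\<rho> g)" if "g \<in> carrier G"
  proof -
    note rg = is_repD(1)[OF \<rho> that]
    have "mat_trace (Q * \<rho> g * P) = mat_trace (P * (Q * \<rho> g))"
      using P Q rg by (intro mat_trace_comm[of _ d d]) auto
    also have "P * (Q * \<rho> g) = P * Q * \<rho> g" using P Q rg by simp
    finally show ?thesis using PQ rg by simp
  qed
qed

text \<open>The diagonal block of \<open>R\<close> on the indices in \<open>T\<close> is
  multiplicative as soon as no product passes through an index outside \<open>T\<close>. In block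
  triangular form this holds both for the index set of the invariant subspace and for its
  complement: in the first case the right factor vanishes, in the second the left one. One statement
  thus yields the subrepresentation and the quotient.\<close>

lemma compress_rep:
  assumes R: "is_rep G d R" and T: "T \<subseteq> {..<d}" and "group G"
    and zero: "\<And>g h i j l. g \<in> carrier G \<Longrightarrow> h \<in> carrier G \<Longrightarrow> i \<in> T \<Longrightarrow> j \<in> T \<Longrightarrow> l < d \<Longrightarrow> l \<notin> T
      \<Longrightarrow> R g $$ (i,l) * R h $$ (l,j) = 0"
  obtains \<tau> where "is_rep G (card T) \<tau>"
    "\<And>g. g \<in> carrier G \<Longrightarrow> mat_trace (\<tau> g) = (\<Sum>i\<in>T. R g $$ (i,i))"
proof -
  interpret group G by fact
  have fin: "finite T" using T finite_subset by blast
  obtain e where e: "bij_betw e {0..<card T} T" using ex_bij_betw_nat_finite[OF fin] by blast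
  then have eT: "e a \<in> T" "e a < d" if "a < card T" for a
    using that T by (auto simp: bij_betw_def)
  have einj: "e a = e b \<longleftrightarrow> a = b" if "a < card T" "b < card T" for a b
    using e that by (auto simp: bij_betw_def inj_on_def)
  define \<tau> where "\<tau> g = mat (card T) (card T) (\<lambda>(a,b). R g $$ (e a, e b))" for g
  have mult: "\<tau> (g \<otimes>\<^bsub>G\<^esub> h) = \<tau> g * \<tau> h" if gh: "g \<in> carrier G" "h \<in> carrier G" for g h
  proof (rule eq_matI)
    fix a b assume "a < dim_row (\<tau> g * \<tau> h)" "b < dim_col (\<tau> g * \<tau> h)"
    then have ab: "a < card T" "b < card T" by (auto simp: \<tau>_def)
    note rg = is_repD(1)[OF R gh(1)] and rh = is_repD(1)[OF R gh(2)]
    have "\<tau> (g \<otimes>\<^bsub>G\<^esub> h) $$ (a,b) = (R g * R h) $$ (e a, e b)"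
      using ab gh by (simp add: \<tau>_def is_repD(2)[OF R])
    also have "\<dots> = (\<Sum>l<d. R g $$ (e a, l) * R h $$ (l, e b))"
      using rg rh eT ab by (simp add: scalar_prod_def atLeast0LessThan)
    also have "\<dots> = (\<Sum>l\<in>T. R g $$ (e a, l) * R h $$ (l, e b))"
      using T zero[OF gh] eT ab by (intro sum.mono_neutral_right) auto
    also have "\<dots> = (\<Sum>c\<in>{0..<card T}. R g $$ (e a, e c) * R h $$ (e c, e b))"
      using sum.reindex_bij_betw[OF e, of "\<lambda>l. R g $$ (e a, l) * R h $$ (l, e b)"] by simp
    also have "\<dots> = (\<tau> g * \<tau> h) $$ (a,b)" using ab by (simp add: \<tau>_def scalar_prod_def)
    finally show "\<tau> (g \<otimes>\<^bsub>G\<^esub> h) $$ (a,b) = (\<tau> g * \<tau> h) $$ (a,b)" .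
  qed (auto simp: \<tau>_def)
  have "\<tau> \<one>\<^bsub>G\<^esub> = 1\<^sub>m (card T)"
    by (intro eq_matI) (auto simp: \<tau>_def is_repD(3)[OF R] eT einj)
  then have "is_rep G (card T) \<tau>" using mult by (auto simp: is_rep_def) (auto simp: \<tau>_def)
  moreover have "mat_trace (\<tau> g) = (\<Sum>i\<in>T. R g $$ (i,i))" for g
    using sum.reindex_bij_betw[OF e, of "\<lambda>i. R g $$ (i,i)"]
    by (simp add: mat_trace_def \<tau>_def atLeast0LessThan)
  ultimately show thesis using that by blast
qed

text \<open>Induction on the dimension. In a basis adapted to a proper nonzero invariant subspace
  the matrices are block triangular, and the trace is the sum of the traces of the two smaller
  diagonal blocks. Irreducibility includes d > 0, so dimension 0 is covered by the empty
  list.\<close>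

lemma character_sum_of_irreps:
  assumes "group G" "is_rep G d \<rho>"
  shows "\<exists>xs. (\<forall>(e,\<sigma>)\<in>set xs. is_irrep G e \<sigma>) \<and>
    (\<forall>g\<in>carrier G. mat_trace (\<rho> g) = (\<Sum>(e,\<sigma>)\<leftarrow>xs. mat_trace (\<sigma> g)))"
  using assms(2)
proof (induction d arbitrary: \<rho> rule: less_induct)
  case (less d)
  interpret group G by fact
  consider "d = 0" | "is_irrep G d \<rho>" | "d > 0" "\<not> is_irrep G d \<rho>" by auto
  then show ?case
  proof cases
    case 1
    then have "mat_trace (\<rho> g) = 0" if "g \<in> carrier G" for g
      using carrier_matD(1)[OF is_repD(1)[OF less.prems that]] by (simp add: mat_trace_def)
    then show ?thesis by (intro exI[of _ "[]"]) auto
  next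
    case 2
    then show ?thesis by (intro exI[of _ "[(d,\<rho>)]"]) auto
  next
    case 3
    then obtain W where inv: "invariant_subspace G d \<rho> W" and ne: "W \<noteq> {0\<^sub>v d}" "W \<noteq> carrier_vec d"
      using less.prems by (auto simp: is_irrep_def)
    then obtain P Q S where P: "P \<in> carrier_mat d d" and Q: "Q \<in> carrier_mat d d"
      and PQ: "P * Q = 1\<^sub>m d" and QP: "Q * P = 1\<^sub>m d"
      and S: "S \<subset> {..<d}" "S \<noteq> {}" and colS: "\<And>j. j \<in> S \<Longrightarrow> col P j \<in> W"
      and supp: "\<And>w i. w \<in> W \<Longrightarrow> i < d \<Longrightarrow> i \<notin> S \<Longrightarrow> (Q *\<^sub>v w) $ i = 0"
      using adapted_basis[of W d] unfolding invariant_subspace_def by metis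
    define R where "R g = Q * \<rho> g * P" for g
    have R: "is_rep G d R" and trR: "\<And>g. g \<in> carrier G \<Longrightarrow> mat_trace (R g) = mat_trace (\<rho> g)"
      using conjugate_rep[OF less.prems P Q PQ QP \<open>group G\<close>] unfolding R_def by auto
    \<comment> \<open>Block triangularity: for j in \<open>S\<close> the vector
      \<open>\<rho> g *\<^sub>v col P j\<close> stays in \<open>W\<close>, and its coordinates in
      the basis \<open>P\<close> vanish outside \<open>S\<close>.\<close>
    have zero: "R g $$ (i,j) = 0" if g: "g \<in> carrier G" and ij: "i < d" "i \<notin> S" "j \<in> S" for g i j
    proof -
      note rg = is_repD(1)[OF less.prems g]
      have jd: "j < d" using S ij by auto
      have cP: "col P j \<in> carrier_vec d" using P by auto
      have "R g $$ (i,j) = (Q *\<^sub>v (\<rho> g *\<^sub>v col P j)) $ i"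
      proof -
        have "R g $$ (i,j) = col (R g) j $ i" using is_repD(1)[OF R g] ij jd by simp
        also have "col (R g) j = (Q * \<rho> g) *\<^sub>v col P j"
          unfolding R_def using P Q rg jd by (intro col_mult2) auto
        also have "(Q * \<rho> g) *\<^sub>v col P j = Q *\<^sub>v (\<rho> g *\<^sub>v col P j)"
          using Q rg cP by simp
        finally show ?thesis .
      qed
      moreover have "\<rho> g *\<^sub>v col P j \<in> W" using inv colS ij g by (auto simp: invariant_subspace_def)
      ultimately show ?thesis using supp ij by simp
    qed
    let ?S' = "{..<d} - S"
    obtain \<tau> where t: "is_rep G (card S) \<tau>" "\<And>g. g \<in> carrier G \<Longrightarrow> mat_trace (\<tau> g) = (\<Sum>i\<in>S. R g $$ (i,i))"
    proof (rule compress_rep[OF R _ \<open>group G\<close>, of S])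
      show "S \<subseteq> {..<d}" using S by blast
    qed (use zero in simp_all)
    obtain \<tau>' where t': "is_rep G (card ?S') \<tau>'" "\<And>g. g \<in> carrier G \<Longrightarrow> mat_trace (\<tau>' g) = (\<Sum>i\<in>?S'. R g $$ (i,i))"
    proof (rule compress_rep[OF R _ \<open>group G\<close>, of ?S'])
      show "?S' \<subseteq> {..<d}" by blast
    qed (use zero in simp_all)
    have "?S' \<subset> {..<d}" using S by blast
    then have c: "card S < d" "card ?S' < d"
      using psubset_card_mono[OF _ S(1)] psubset_card_mono[of "{..<d}" ?S'] by simp_all
    obtain xs where xs: "\<forall>(e,\<sigma>)\<in>set xs. is_irrep G e \<sigma>"
        "\<forall>g\<in>carrier G. mat_trace (\<tau> g) = (\<Sum>(e,\<sigma>)\<leftarrow>xs. mat_trace (\<sigma> g))"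
      using less.IH[OF c(1) t(1)] by blast
    obtain ys where ys: "\<forall>(e,\<sigma>)\<in>set ys. is_irrep G e \<sigma>"
        "\<forall>g\<in>carrier G. mat_trace (\<tau>' g) = (\<Sum>(e,\<sigma>)\<leftarrow>ys. mat_trace (\<sigma> g))"
      using less.IH[OF c(2) t'(1)] by blast
    have "mat_trace (\<rho> g) = mat_trace (\<tau> g) + mat_trace (\<tau>' g)" if g: "g \<in> carrier G" for g
    proof -
      have "mat_trace (\<rho> g) = (\<Sum>i<d. R g $$ (i,i))"
        using carrier_matD(1)[OF is_repD(1)[OF R g]] by (subst trR[OF g, symmetric]) (simp add: mat_trace_def)
      also have "\<dots> = (\<Sum>i\<in>?S'. R g $$ (i,i)) + (\<Sum>i\<in>S. R g $$ (i,i))"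
        using S by (intro sum.subset_diff) auto
      finally show ?thesis using t t' g by simp
    qed
    then show ?thesis using xs ys by (intro exI[of _ "xs @ ys"]) auto
  qed
qed

section \<open>Orthogonality of characters\<close>

locale fin_group = group G for G :: "('a, 'b) monoid_scheme" (structure) +
  assumes fin: "finite (carrier G)"
begin

lemma card_pos: "card (carrier G) > 0"
  using fin by (simp add: card_gt_0_iff) (metis one_closed empty_iff)

lemma sum_lmult:
  assumes "g \<in> carrier G"
  shows "(\<Sum>t\<in>carrier G. F (g \<otimes> t)) = (\<Sum>t\<in>carrier G. F t)"
  by (rule sum.reindex_bij_witness[of _ "\<lambda>t. inv g \<otimes> t" "\<lambda>t. g \<otimes> t"])
    (use assms in \<open>auto simp flip: m_assoc\<close>)

lemma sum_rmult:
  assumes "g \<in> carrier G"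
  shows "(\<Sum>t\<in>carrier G. F (t \<otimes> g)) = (\<Sum>t\<in>carrier G. F t)"
  by (rule sum.reindex_bij_witness[of _ "\<lambda>t. t \<otimes> inv g" "\<lambda>t. t \<otimes> g"])
    (use assms in \<open>auto simp: m_assoc\<close>)

lemma sum_inv: "(\<Sum>t\<in>carrier G. F (inv t)) = (\<Sum>t\<in>carrier G. F t)"
  by (rule sum.reindex_bij_witness[of _ "\<lambda>t. inv t" "\<lambda>t. inv t"]) auto

text \<open>Cut off outside the carrier, where a representation is unconstrained, so that the
  character is an element of \<open>L1 G\<close>.\<close>

definition rep_char :: "('a \<Rightarrow> complex mat) \<Rightarrow> 'a \<Rightarrow> complex" where
  "rep_char \<rho> g = (if g \<in> carrier G then mat_trace (\<rho> g) else 0)"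

lemma rep_mult_entry:
  assumes "is_rep G d \<rho>" "g \<in> carrier G" "h \<in> carrier G" "i < d" "j < d"
  shows "\<rho> (g \<otimes> h) $$ (i,j) = (\<Sum>c<d. \<rho> g $$ (i,c) * \<rho> h $$ (c,j))"
  using is_repD(1)[OF assms(1,2)] is_repD(1)[OF assms(1,3)] assms
  by (simp add: is_repD(2) scalar_prod_def atLeast0LessThan)

lemma rep_char_eq:
  assumes "is_rep G d \<rho>" "g \<in> carrier G"
  shows "rep_char \<rho> g = (\<Sum>i<d. \<rho> g $$ (i,i))"
  using carrier_matD(1)[OF is_repD(1)[OF assms]] assms by (simp add: rep_char_def mat_trace_def)

lemma rep_char_one: "is_rep G d \<rho> \<Longrightarrow> rep_char \<rho> \<one> = of_nat d"
  by (simp add: rep_char_eq is_repD(3))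

text \<open>\<open>X\<close> is the sum over t of sigma(t) E rho(t^-1), where E is the e by d matrix
  unit at (i,j). Replacing t by g t moves g from the right of \<open>X\<close> to its left.\<close>

lemma average_intertwines:
  assumes \<rho>: "is_rep G d \<rho>" and \<sigma>: "is_rep G e \<sigma>" and i: "i < e" and j: "j < d" and g: "g \<in> carrier G"
  defines "X \<equiv> mat e d (\<lambda>(a,b). \<Sum>t\<in>carrier G. \<sigma> t $$ (a,i) * \<rho> (inv t) $$ (j,b))"
  shows "X * \<rho> g = \<sigma> g * X"
proof (rule eq_matI)
  note rg = is_repD(1)[OF \<rho> g] and sg = is_repD(1)[OF \<sigma> g]
  fix a b assume "a < dim_row (\<sigma> g * X)" "b < dim_col (\<sigma> g * X)"
  then have ab: "a < e" "b < d" using sg by (auto simp: X_def)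
  have "(X * \<rho> g) $$ (a,b) = (\<Sum>c<d. (\<Sum>t\<in>carrier G. \<sigma> t $$ (a,i) * \<rho> (inv t) $$ (j,c)) * \<rho> g $$ (c,b))"
    using ab rg by (simp add: X_def scalar_prod_def atLeast0LessThan)
  also have "\<dots> = (\<Sum>t\<in>carrier G. \<sigma> t $$ (a,i) * (\<Sum>c<d. \<rho> (inv t) $$ (j,c) * \<rho> g $$ (c,b)))"
    unfolding sum_distrib_left sum_distrib_right by (subst sum.swap) (simp add: mult.assoc)
  also have "\<dots> = (\<Sum>t\<in>carrier G. \<sigma> t $$ (a,i) * \<rho> (inv t \<otimes> g) $$ (j,b))"
    using ab j g by (intro sum.cong) (simp_all add: rep_mult_entry[OF \<rho>])
  also have "\<dots> = (\<Sum>t\<in>carrier G. \<sigma> (g \<otimes> t) $$ (a,i) * \<rho> (inv (g \<otimes> t) \<otimes> g) $$ (j,b))"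
    by (rule sum_lmult[OF g, symmetric])
  also have "\<dots> = (\<Sum>t\<in>carrier G. (\<Sum>c<e. \<sigma> g $$ (a,c) * \<sigma> t $$ (c,i)) * \<rho> (inv t) $$ (j,b))"
    using ab i g by (intro sum.cong) (simp_all add: rep_mult_entry[OF \<sigma>] inv_mult_group m_assoc)
  also have "\<dots> = (\<Sum>c<e. \<sigma> g $$ (a,c) * (\<Sum>t\<in>carrier G. \<sigma> t $$ (c,i) * \<rho> (inv t) $$ (j,b)))"
    unfolding sum_distrib_left sum_distrib_right by (subst sum.swap) (simp add: mult.assoc)
  also have "\<dots> = (\<sigma> g * X) $$ (a,b)"
    using ab sg by (simp add: X_def scalar_prod_def atLeast0LessThan)
  finally show "(X * \<rho> g) $$ (a,b) = (\<sigma> g * X) $$ (a,b)" .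
qed (use is_repD(1)[OF \<rho> g] is_repD(1)[OF \<sigma> g] in \<open>auto simp: X_def\<close>)

text \<open>The sum is an entry of the averaged matrix unit; were that intertwiner nonzero, it would
  be an equivalence.\<close>

lemma entry_orthogonality_inequivalent:
  assumes \<rho>: "is_irrep G d \<rho>" and \<sigma>: "is_irrep G e \<sigma>" and ne: "((d,\<rho>),(e,\<sigma>)) \<notin> rep_equiv G"
    and "a < e" "i < e" "j < d" "b < d"
  shows "(\<Sum>t\<in>carrier G. \<sigma> t $$ (a,i) * \<rho> (inv t) $$ (j,b)) = 0"
proof -
  define X where "X = mat e d (\<lambda>(a,b). \<Sum>t\<in>carrier G. \<sigma> t $$ (a,i) * \<rho> (inv t) $$ (j,b))"
  have X: "X \<in> carrier_mat e d" by (simp add: X_def)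
  have tw: "X * \<rho> g = \<sigma> g * X" if "g \<in> carrier G" for g
    unfolding X_def using average_intertwines[OF is_irrepD(2)[OF \<rho>] is_irrepD(2)[OF \<sigma>] \<open>i < e\<close> \<open>j < d\<close> that] .
  have "X = 0\<^sub>m e d"
  proof (rule ccontr)
    assume "X \<noteq> 0\<^sub>m e d"
    then have "d = e" "invertible_mat X" using schur_nonzero_intertwiner[OF \<rho> \<sigma> X tw] by blast+
    then have "((d,\<rho>),(e,\<sigma>)) \<in> rep_equiv G"
      using \<rho> \<sigma> X tw by (auto simp: rep_equiv_def)
    with ne show False ..
  qed
  then have "X $$ (a,b) = 0" using \<open>a < e\<close> \<open>b < d\<close> by simp
  then show ?thesis using \<open>a < e\<close> \<open>b < d\<close> by (simp add: X_def)
qed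

text \<open>The averaged matrix unit is a scalar c. Its trace d c equals the sum over t of the (j,i)
  entry of rho(t^-1) rho(t), which is |G| for i = j and 0 otherwise; this is the origin of the
  constant |G|/d.\<close>

lemma entry_orthogonality:
  assumes \<rho>: "is_irrep G d \<rho>" and ind: "a < d" "i < d" "j < d" "b < d"
  shows "(\<Sum>t\<in>carrier G. \<rho> t $$ (a,i) * \<rho> (inv t) $$ (j,b)) =
    (if a = b \<and> i = j then of_nat (card (carrier G)) / of_nat d else 0)"
proof -
  define X where "X = mat d d (\<lambda>(a,b). \<Sum>t\<in>carrier G. \<rho> t $$ (a,i) * \<rho> (inv t) $$ (j,b))"
  have X: "X \<in> carrier_mat d d" by (simp add: X_def)
  note r = is_irrepD(2)[OF \<rho>]
  have tw: "X * \<rho> g = \<rho> g * X" if "g \<in> carrier G" for g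
    unfolding X_def using average_intertwines[OF r r ind(2,3) that] .
  obtain c where c: "X = c \<cdot>\<^sub>m 1\<^sub>m d" using schur_scalar[OF \<rho> X tw] .
  have "of_nat d * c = (\<Sum>a<d. X $$ (a,a))" by (simp add: c)
  also have "\<dots> = (\<Sum>t\<in>carrier G. \<Sum>a<d. \<rho> (inv t) $$ (j,a) * \<rho> t $$ (a,i))"
    by (subst sum.swap) (simp add: X_def mult.commute)
  also have "\<dots> = (\<Sum>t\<in>carrier G. 1\<^sub>m d $$ (j,i))"
    using ind by (intro sum.cong) (simp_all flip: rep_mult_entry[OF r] add: is_repD(3)[OF r])
  finally have "of_nat d * c = of_nat (card (carrier G)) * (if i = j then 1 else 0)" using ind by auto
  then have "c = (if i = j then of_nat (card (carrier G)) / of_nat d else 0)"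
    using is_irrepD(1)[OF \<rho>] by (auto simp: field_simps split: if_splits)
  moreover have "X $$ (a,b) = (if a = b then c else 0)" using ind by (simp add: c)
  ultimately show ?thesis using ind by (simp add: X_def)
qed

text \<open>Expanding the trace of rho(t^-1) rho(s) isolates the sum over t in the shape of the
  orthogonality relations for entries.\<close>

lemma conv_rep_char:
  assumes \<rho>: "is_rep G d \<rho>" and \<sigma>: "is_rep G e \<sigma>" and s: "s \<in> carrier G"
  shows "conv G (rep_char \<sigma>) (rep_char \<rho>) s =
    (\<Sum>a<e. \<Sum>b<d. \<Sum>c<d. (\<Sum>t\<in>carrier G. \<sigma> t $$ (a,a) * \<rho> (inv t) $$ (b,c)) * \<rho> s $$ (c,b))
      / of_nat (card (carrier G))"
proof -
  have "rep_char \<sigma> t * rep_char \<rho> (inv t \<otimes> s) =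
      (\<Sum>a<e. \<Sum>b<d. \<Sum>c<d. \<sigma> t $$ (a,a) * \<rho> (inv t) $$ (b,c) * \<rho> s $$ (c,b))" if t: "t \<in> carrier G" for t
    using s t by (simp add: rep_char_eq[OF \<rho>] rep_char_eq[OF \<sigma>] rep_mult_entry[OF \<rho>] sum_distrib_right)
      (simp add: sum_distrib_left mult.assoc)
  then have "(\<Sum>t\<in>carrier G. rep_char \<sigma> t * rep_char \<rho> (inv t \<otimes> s)) =
      (\<Sum>t\<in>carrier G. \<Sum>a<e. \<Sum>b<d. \<Sum>c<d. \<sigma> t $$ (a,a) * \<rho> (inv t) $$ (b,c) * \<rho> s $$ (c,b))"
    by (intro sum.cong) auto
  also have "\<dots> = (\<Sum>a<e. \<Sum>b<d. \<Sum>c<d. \<Sum>t\<in>carrier G. \<sigma> t $$ (a,a) * \<rho> (inv t) $$ (b,c) * \<rho> s $$ (c,b))"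
    by (subst sum.swap, rule sum.cong[OF refl], subst sum.swap, rule sum.cong[OF refl], rule sum.swap)
  finally show ?thesis using s by (simp add: conv_def sum_distrib_right)
qed

lemma conv_char_inequivalent:
  assumes "is_irrep G d \<rho>" "is_irrep G e \<sigma>" "((d,\<rho>),(e,\<sigma>)) \<notin> rep_equiv G"
  shows "conv G (rep_char \<sigma>) (rep_char \<rho>) = (\<lambda>s. 0)"
proof
  fix s show "conv G (rep_char \<sigma>) (rep_char \<rho>) s = 0"
  proof (cases "s \<in> carrier G")
    case True
    then show ?thesis unfolding conv_rep_char[OF is_irrepD(2)[OF assms(1)] is_irrepD(2)[OF assms(2)] True]
      by (simp add: entry_orthogonality_inequivalent[OF assms])
  qed (simp add: conv_def)
qed

text \<open>Orthogonality leaves only b = c = a, with the constant |G|/d; the division by |G| in the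
  convolution reduces it to 1/d.\<close>

lemma conv_char_self:
  assumes \<rho>: "is_irrep G d \<rho>"
  shows "conv G (rep_char \<rho>) (rep_char \<rho>) = (\<lambda>s. rep_char \<rho> s / of_nat d)"
proof
  fix s
  let ?N = "of_nat (card (carrier G)) :: complex"
  note r = is_irrepD(2)[OF \<rho>]
  show "conv G (rep_char \<rho>) (rep_char \<rho>) s = rep_char \<rho> s / of_nat d"
  proof (cases "s \<in> carrier G")
    case True
    have "(\<Sum>b<d. \<Sum>c<d. (\<Sum>t\<in>carrier G. \<rho> t $$ (a,a) * \<rho> (inv t) $$ (b,c)) * \<rho> s $$ (c,b))
        = ?N / of_nat d * \<rho> s $$ (a,a)" if a: "a < d" for a
    proof -
      have "(\<Sum>b<d. \<Sum>c<d. (\<Sum>t\<in>carrier G. \<rho> t $$ (a,a) * \<rho> (inv t) $$ (b,c)) * \<rho> s $$ (c,b))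
          = (\<Sum>b<d. \<Sum>c<d. if a = c then (if a = b then ?N / of_nat d * \<rho> s $$ (c,b) else 0) else 0)"
        using a by (intro sum.cong refl) (simp add: entry_orthogonality[OF \<rho>])
      also have "\<dots> = ?N / of_nat d * \<rho> s $$ (a,a)" using a by (simp add: sum.delta)
      finally show ?thesis .
    qed
    then show ?thesis unfolding conv_rep_char[OF r r True] using card_pos True
      by (simp add: rep_char_eq[OF r] sum_divide_distrib)
  qed (simp add: conv_def rep_char_def)
qed

section \<open>Central functions and their action on characters\<close>

text \<open>Commuting with point masses already forces f(xy) = f(yx), and conversely this invariance
  lets the two factors of a convolution be exchanged by substitution.\<close>

lemma ZL1_iff: "f \<in> ZL1 G \<longleftrightarrow> f \<in> L1 G \<and> (\<forall>x\<in>carrier G. \<forall>y\<in>carrier G. f (x \<otimes> y) = f (y \<otimes> x))"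
proof (intro iffI conjI ballI)
  show "f \<in> L1 G" if "f \<in> ZL1 G" using that by (simp add: ZL1_def)
next
  fix x y assume f: "f \<in> ZL1 G" and xy: "x \<in> carrier G" "y \<in> carrier G"
  \<comment> \<open>With the point mass at y^-1, (f * h)(x) is f(xy)/|G| and (h * f)(x) is
    f(yx)/|G|.\<close>
  define h :: "'a \<Rightarrow> complex" where "h t = (if t = inv y then 1 else 0)" for t
  have "h \<in> L1 G" using xy by (auto simp: h_def L1_def)
  then have "conv G f h x = conv G h f x" using f by (simp add: ZL1_def)
  moreover have "(\<Sum>t\<in>carrier G. f t * h (inv t \<otimes> x)) = (\<Sum>t\<in>carrier G. if t = x \<otimes> y then f t else 0)"
  proof (intro sum.cong refl)
    fix t assume t: "t \<in> carrier G"
    have "inv t \<otimes> x = inv y \<longleftrightarrow> t = x \<otimes> y"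
    proof
      assume "inv t \<otimes> x = inv y"
      then have "t \<otimes> (inv t \<otimes> x) \<otimes> y = t \<otimes> inv y \<otimes> y" by simp
      then show "t = x \<otimes> y" using t xy by (simp add: m_assoc[symmetric]) (simp add: m_assoc)
    qed (use t xy in \<open>simp add: inv_mult_group m_assoc\<close>)
    then show "f t * h (inv t \<otimes> x) = (if t = x \<otimes> y then f t else 0)" by (simp add: h_def)
  qed
  moreover have "(\<Sum>t\<in>carrier G. h t * f (inv t \<otimes> x)) = (\<Sum>t\<in>carrier G. if t = inv y then f (y \<otimes> x) else 0)"
    using xy by (intro sum.cong refl) (auto simp: h_def)
  ultimately show "f (x \<otimes> y) = f (y \<otimes> x)"
    using xy fin card_pos by (auto simp: conv_def)
next
  assume f: "f \<in> L1 G \<and> (\<forall>x\<in>carrier G. \<forall>y\<in>carrier G. f (x \<otimes> y) = f (y \<otimes> x))"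
  have "conv G f g s = conv G g f s" for g s
  proof (cases "s \<in> carrier G")
    case True
    have "(\<Sum>t\<in>carrier G. f t * g (inv t \<otimes> s)) = (\<Sum>u\<in>carrier G. g u * f (inv u \<otimes> s))"
    \<comment> \<open>For u = t^-1 s the argument u^-1 s equals s^-1 t s, a conjugate of t, on which
      f takes the value f(t).\<close>
    proof (rule sum.reindex_bij_witness[of _ "\<lambda>u. s \<otimes> inv u" "\<lambda>t. inv t \<otimes> s"])
      fix t assume t: "t \<in> carrier G"
      show "s \<otimes> inv (inv t \<otimes> s) = t"
        using t True by (simp add: inv_mult_group m_assoc[symmetric])
      have "inv (inv t \<otimes> s) \<otimes> s = inv s \<otimes> (t \<otimes> s)" using t True by (simp add: inv_mult_group m_assoc)
      also have "f \<dots> = f (t \<otimes> s \<otimes> inv s)" using f t True by simp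
      also have "t \<otimes> s \<otimes> inv s = t" using t True by (simp add: m_assoc)
      finally show "g (inv t \<otimes> s) * f (inv (inv t \<otimes> s) \<otimes> s) = f t * g (inv t \<otimes> s)" by simp
    next
      fix u assume u: "u \<in> carrier G"
      show "inv (s \<otimes> inv u) \<otimes> s = u"
        using u True by (simp add: inv_mult_group m_assoc)
    qed (use True in auto)
    then show ?thesis by (simp add: conv_def)
  qed (simp add: conv_def)
  then show "f \<in> ZL1 G" using f by (auto simp: ZL1_def)
qed

lemma conv_commute: "f \<in> ZL1 G \<Longrightarrow> g \<in> L1 G \<Longrightarrow> conv G f g = conv G g f"
  by (simp add: ZL1_def)

lemma rep_char_ZL1:
  assumes \<rho>: "is_rep G d \<rho>"
  shows "rep_char \<rho> \<in> ZL1 G"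
  unfolding ZL1_iff
proof (intro conjI ballI)
  show "rep_char \<rho> \<in> L1 G" by (simp add: L1_def rep_char_def)
  fix x y assume "x \<in> carrier G" "y \<in> carrier G"
  then show "rep_char \<rho> (x \<otimes> y) = rep_char \<rho> (y \<otimes> x)"
    using \<rho> mat_trace_comm[of "\<rho> x" d d "\<rho> y"] by (simp add: rep_char_def is_rep_def)
qed

text \<open>The matrix Y = sum_t f(t) rho(t^-1) commutes with every rho(g), because f is invariant
  under t -> g t g^-1. By Schur it is a scalar c, and (f * chi)(s) is the trace of Y rho(s) divided
  by |G|, so the eigenvalue is c/|G|.\<close>

lemma conv_rep_char_eigen:
  assumes \<rho>: "is_irrep G d \<rho>" and f: "f \<in> ZL1 G"
  obtains c where "conv G f (rep_char \<rho>) = (\<lambda>s. c * rep_char \<rho> s)"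
proof -
  note r = is_irrepD(2)[OF \<rho>]
  define Y where "Y = mat d d (\<lambda>(i,j). \<Sum>t\<in>carrier G. f t * \<rho> (inv t) $$ (i,j))"
  have Y: "Y \<in> carrier_mat d d" by (simp add: Y_def)
  have Yg: "(Y * \<rho> g) $$ (i,j) = (\<Sum>t\<in>carrier G. f t * \<rho> (inv t \<otimes> g) $$ (i,j))"
    if g: "g \<in> carrier G" and ij: "i < d" "j < d" for g i j
  proof -
    have "(Y * \<rho> g) $$ (i,j) = (\<Sum>c<d. (\<Sum>t\<in>carrier G. f t * \<rho> (inv t) $$ (i,c)) * \<rho> g $$ (c,j))"
      using ij is_repD(1)[OF r g] by (simp add: Y_def scalar_prod_def atLeast0LessThan)
    also have "\<dots> = (\<Sum>t\<in>carrier G. f t * (\<Sum>c<d. \<rho> (inv t) $$ (i,c) * \<rho> g $$ (c,j)))"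
      unfolding sum_distrib_left sum_distrib_right by (subst sum.swap) (simp add: mult.assoc)
    also have "\<dots> = (\<Sum>t\<in>carrier G. f t * \<rho> (inv t \<otimes> g) $$ (i,j))"
      using ij g by (intro sum.cong) (simp_all add: rep_mult_entry[OF r])
    finally show ?thesis .
  qed
  have tw: "Y * \<rho> g = \<rho> g * Y" if g: "g \<in> carrier G" for g
  proof (rule eq_matI)
    fix i j assume "i < dim_row (\<rho> g * Y)" "j < dim_col (\<rho> g * Y)"
    then have ij: "i < d" "j < d" using is_repD(1)[OF r g] by (auto simp: Y_def)
    have "(\<rho> g * Y) $$ (i,j) = (\<Sum>c<d. \<rho> g $$ (i,c) * (\<Sum>t\<in>carrier G. f t * \<rho> (inv t) $$ (c,j)))"
      using ij is_repD(1)[OF r g] by (simp add: Y_def scalar_prod_def atLeast0LessThan)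
    also have "\<dots> = (\<Sum>t\<in>carrier G. f t * (\<Sum>c<d. \<rho> g $$ (i,c) * \<rho> (inv t) $$ (c,j)))"
      unfolding sum_distrib_left sum_distrib_right by (subst sum.swap) (simp add: mult.left_commute)
    also have "\<dots> = (\<Sum>t\<in>carrier G. f t * \<rho> (g \<otimes> inv t) $$ (i,j))"
      using ij g by (intro sum.cong) (simp_all add: rep_mult_entry[OF r])
    also have "\<dots> = (\<Sum>t\<in>carrier G. f t * \<rho> (inv t \<otimes> g) $$ (i,j))"
    proof (rule sum.reindex_bij_witness[of _ "\<lambda>t. inv g \<otimes> t \<otimes> g" "\<lambda>t. g \<otimes> t \<otimes> inv g"])
      fix t assume t: "t \<in> carrier G"
      have "f (g \<otimes> t \<otimes> inv g) = f (inv g \<otimes> (g \<otimes> t))" using f g t by (simp add: ZL1_iff)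
      also have "inv g \<otimes> (g \<otimes> t) = t" using g t by (simp add: m_assoc[symmetric])
      finally show "f (g \<otimes> t \<otimes> inv g) * \<rho> (inv (g \<otimes> t \<otimes> inv g) \<otimes> g) $$ (i,j) = f t * \<rho> (g \<otimes> inv t) $$ (i,j)"
        using g t by (simp add: inv_mult_group m_assoc)
      show "inv g \<otimes> (g \<otimes> t \<otimes> inv g) \<otimes> g = t" using g t by (simp add: m_assoc) (simp add: m_assoc[symmetric])
      show "g \<otimes> (inv g \<otimes> t \<otimes> g) \<otimes> inv g = t" using g t by (simp add: m_assoc) (simp add: m_assoc[symmetric])
    qed (use g in auto)
    finally show "(Y * \<rho> g) $$ (i,j) = (\<rho> g * Y) $$ (i,j)" using Yg[OF g ij] by simp
  qed (use is_repD(1)[OF r g] in \<open>auto simp: Y_def\<close>)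
  obtain c where c: "Y = c \<cdot>\<^sub>m 1\<^sub>m d" using schur_scalar[OF \<rho> Y tw] .
  have "conv G f (rep_char \<rho>) s = c / of_nat (card (carrier G)) * rep_char \<rho> s" for s
  proof (cases "s \<in> carrier G")
    case True
    have "(\<Sum>t\<in>carrier G. f t * rep_char \<rho> (inv t \<otimes> s)) = (\<Sum>i<d. (Y * \<rho> s) $$ (i,i))"
      using True by (simp add: Yg rep_char_eq[OF r] sum_distrib_left) (rule sum.swap)
    also have "Y * \<rho> s = c \<cdot>\<^sub>m \<rho> s"
      using is_repD(1)[OF r True] by (simp add: c mult_smult_assoc_mat[of _ d d _ d])
    also have "(\<Sum>i<d. (c \<cdot>\<^sub>m \<rho> s) $$ (i,i)) = c * rep_char \<rho> s"
      using True is_repD(1)[OF r True] by (simp add: rep_char_eq[OF r] sum_distrib_left)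
    finally show ?thesis using True by (simp add: conv_def)
  qed (simp add: conv_def rep_char_def)
  then show thesis using that by blast
qed

text \<open>Averaging gives a positive definite matrix \<open>H\<close> that intertwines \<open>\<rho>\<close> with its conjugate dual.\<close>
lemma rep_char_inv:
  assumes \<rho>: "is_rep G d \<rho>" and g: "g \<in> carrier G"
  shows "rep_char \<rho> (inv g) = cnj (rep_char \<rho> g)"
proof -
  \<comment> \<open>\<open>H\<close> is the sum of rho(t)^* rho(t), and \<open>R\<close> below is
    the conjugate transpose of rho(g^-1). Moving rho(g^-1) into the first factor and replacing t by
    t g gives R H = H rho(g).\<close>
  define H where "H = mat d d (\<lambda>(i,j). \<Sum>t\<in>carrier G. \<Sum>k<d. cnj (\<rho> t $$ (k,i)) * \<rho> t $$ (k,j))"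
  define R where "R = mat d d (\<lambda>(i,j). cnj (\<rho> (inv g) $$ (j,i)))"
  have H: "H \<in> carrier_mat d d" and R: "R \<in> carrier_mat d d" by (simp_all add: H_def R_def)
  note rg = is_repD(1)[OF \<rho> g]
  have tw: "R * H = H * \<rho> g"
  proof (rule eq_matI)
    fix i j assume "i < dim_row (H * \<rho> g)" "j < dim_col (H * \<rho> g)"
    then have ij: "i < d" "j < d" using rg H by auto
    have "(R * H) $$ (i,j) = (\<Sum>l<d. cnj (\<rho> (inv g) $$ (l,i)) * (\<Sum>t\<in>carrier G. \<Sum>k<d. cnj (\<rho> t $$ (k,l)) * \<rho> t $$ (k,j)))"
      using ij by (simp add: R_def H_def scalar_prod_def atLeast0LessThan)
    also have "\<dots> = (\<Sum>t\<in>carrier G. \<Sum>k<d. (\<Sum>l<d. cnj (\<rho> t $$ (k,l)) * cnj (\<rho> (inv g) $$ (l,i))) * \<rho> t $$ (k,j))"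
      unfolding sum_distrib_left sum_distrib_right
      by (subst sum.swap, rule sum.cong[OF refl], subst sum.swap) (simp add: ac_simps)
    also have "\<dots> = (\<Sum>t\<in>carrier G. \<Sum>k<d. cnj (\<rho> (t \<otimes> inv g) $$ (k,i)) * \<rho> t $$ (k,j))"
      using ij g by (intro sum.cong refl) (simp add: rep_mult_entry[OF \<rho>])
    also have "\<dots> = (\<Sum>t\<in>carrier G. \<Sum>k<d. cnj (\<rho> (t \<otimes> g \<otimes> inv g) $$ (k,i)) * \<rho> (t \<otimes> g) $$ (k,j))"
      using sum_rmult[OF g, of "\<lambda>t. \<Sum>k<d. cnj (\<rho> (t \<otimes> inv g) $$ (k,i)) * \<rho> t $$ (k,j)"] by simp
    also have "\<dots> = (\<Sum>t\<in>carrier G. \<Sum>k<d. cnj (\<rho> t $$ (k,i)) * (\<Sum>l<d. \<rho> t $$ (k,l) * \<rho> g $$ (l,j)))"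
      using ij g by (intro sum.cong refl) (simp add: rep_mult_entry[OF \<rho>] m_assoc)
    also have "\<dots> = (\<Sum>l<d. (\<Sum>t\<in>carrier G. \<Sum>k<d. cnj (\<rho> t $$ (k,i)) * \<rho> t $$ (k,l)) * \<rho> g $$ (l,j))"
      unfolding sum_distrib_left sum_distrib_right
      by (subst (2) sum.swap, rule sum.cong[OF refl], subst sum.swap) (simp add: ac_simps)
    also have "\<dots> = (H * \<rho> g) $$ (i,j)"
      using ij rg by (simp add: H_def scalar_prod_def atLeast0LessThan)
    finally show "(R * H) $$ (i,j) = (H * \<rho> g) $$ (i,j)" .
  qed (use H R rg in auto)
  have "invertible_mat H"
  proof (rule invertible_mat_if_kernel_trivial[OF H])
    fix v assume v: "v \<in> carrier_vec d" "H *\<^sub>v v = 0\<^sub>v d"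
    define w where "w t k = (\<Sum>j<d. \<rho> t $$ (k,j) * v $ j)" for t k
    \<comment> \<open>The quadratic form v^* H v is the sum over t of the squared lengths of w(t) =
      rho(t) v. If it vanishes, the term t = 1 already gives v = 0.\<close>
    have "0 = (\<Sum>i<d. cnj (v $ i) * (H *\<^sub>v v) $ i)" using v by simp
    also have "\<dots> = (\<Sum>i<d. cnj (v $ i) * (\<Sum>j<d. (\<Sum>t\<in>carrier G. \<Sum>k<d. cnj (\<rho> t $$ (k,i)) * \<rho> t $$ (k,j)) * v $ j))"
      using v(1) by (simp add: H_def scalar_prod_def atLeast0LessThan)
    also have "\<dots> = (\<Sum>t\<in>carrier G. \<Sum>k<d. cnj (w t k) * w t k)"
    proof -
      have "(\<Sum>i<d. cnj (v $ i) * (\<Sum>j<d. (\<Sum>t\<in>carrier G. \<Sum>k<d. cnj (\<rho> t $$ (k,i)) * \<rho> t $$ (k,j)) * v $ j))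
        = (\<Sum>i<d. \<Sum>j<d. \<Sum>t\<in>carrier G. \<Sum>k<d. cnj (\<rho> t $$ (k,i) * v $ i) * (\<rho> t $$ (k,j) * v $ j))"
        unfolding sum_distrib_left sum_distrib_right by (simp add: ac_simps)
      also have "\<dots> = (\<Sum>i<d. \<Sum>t\<in>carrier G. \<Sum>k<d. \<Sum>j<d. cnj (\<rho> t $$ (k,i) * v $ i) * (\<rho> t $$ (k,j) * v $ j))"
        by (rule sum.cong[OF refl], subst sum.swap, rule sum.cong[OF refl], rule sum.swap)
      also have "\<dots> = (\<Sum>t\<in>carrier G. \<Sum>k<d. \<Sum>i<d. \<Sum>j<d. cnj (\<rho> t $$ (k,i) * v $ i) * (\<rho> t $$ (k,j) * v $ j))"
        by (subst sum.swap, rule sum.cong[OF refl], rule sum.swap)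
      finally show ?thesis by (simp add: w_def sum_product)
    qed
    also have "\<dots> = of_real (\<Sum>t\<in>carrier G. \<Sum>k<d. (cmod (w t k))\<^sup>2)"
      by (simp add: complex_norm_square mult.commute del: of_real_power)
    finally have "(\<Sum>t\<in>carrier G. \<Sum>k<d. (cmod (w t k))\<^sup>2) = 0"
      by (metis of_real_eq_0_iff)
    then have "\<forall>t\<in>carrier G. (\<Sum>k<d. (cmod (w t k))\<^sup>2) = 0"
      by (subst (asm) sum_nonneg_eq_0_iff) (auto intro: sum_nonneg fin)
    then have "(\<Sum>k<d. (cmod (w \<one> k))\<^sup>2) = 0" by auto
    then have "w \<one> k = 0" if "k < d" for k
      using that by (subst (asm) sum_nonneg_eq_0_iff) auto
    moreover have "w \<one> k = v $ k" if "k < d" for k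
    proof -
      have "w \<one> k = (\<Sum>j<d. if k = j then v $ j else 0)"
        unfolding w_def using that by (intro sum.cong) (auto simp: is_repD(3)[OF \<rho>])
      then show ?thesis using that by simp
    qed
    ultimately show "v = 0\<^sub>v d" using v(1) by (intro eq_vecI) auto
  qed
  then obtain K where K: "K \<in> carrier_mat d d" "H * K = 1\<^sub>m d" "K * H = 1\<^sub>m d"
    using invertible_matD[OF _ H] by blast
  \<comment> \<open>\<open>R\<close> is H rho(g) H^-1, so it has the trace of rho(g); directly from
    its definition its trace is the conjugate of chi(g^-1).\<close>
  have "mat_trace R = mat_trace (R * (H * K))" using R K by simp
  also have "R * (H * K) = (R * H) * K" using R H K(1) by simp
  also have "mat_trace \<dots> = mat_trace (K * (R * H))"
    using R H K(1) by (intro mat_trace_comm[of _ d d]) auto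
  also have "K * (R * H) = (K * H) * \<rho> g" unfolding tw using H K(1) rg by simp
  also have "\<dots> = \<rho> g" using K rg by simp
  finally have "mat_trace R = rep_char \<rho> g" using g by (simp add: rep_char_def)
  moreover have "mat_trace R = cnj (rep_char \<rho> (inv g))"
    using g by (simp add: rep_char_eq[OF \<rho>] mat_trace_def R_def)
  ultimately show ?thesis by (metis complex_cnj_cnj)
qed

section \<open>The central idempotents\<close>

text \<open>Conjugate matrices have equal traces. This makes the choice of a representative inside
  \<open>character\<close> harmless.\<close>

lemma rep_char_rep_equiv:
  assumes "((d,\<rho>),(e,\<sigma>)) \<in> rep_equiv G"
  shows "rep_char \<rho> = rep_char \<sigma>"
proof -
  from assms obtain P where ir: "is_irrep G d \<rho>" "is_irrep G e \<sigma>" and de: "d = e"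
    and P: "P \<in> carrier_mat d d" "invertible_mat P" and tw: "\<And>g. g \<in> carrier G \<Longrightarrow> P * \<rho> g = \<sigma> g * P"
    by (auto simp: rep_equiv_def)
  obtain Q where Q: "Q \<in> carrier_mat d d" "P * Q = 1\<^sub>m d" "Q * P = 1\<^sub>m d" using invertible_matD[OF P(2,1)] .
  have "mat_trace (\<rho> g) = mat_trace (\<sigma> g)" if g: "g \<in> carrier G" for g
  proof -
    have r: "\<rho> g \<in> carrier_mat d d" "\<sigma> g \<in> carrier_mat d d"
      using is_repD(1)[OF is_irrepD(2)[OF ir(1)] g] is_repD(1)[OF is_irrepD(2)[OF ir(2)] g] de by auto
    have "\<rho> g = (Q * P) * \<rho> g" using Q r by simp
    also have "\<dots> = Q * (\<sigma> g * P)" using Q(1) P(1) r tw[OF g] by simp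
    finally have "mat_trace (\<rho> g) = mat_trace (Q * (\<sigma> g * P))" by simp
    also have "\<dots> = mat_trace (\<sigma> g * P * Q)"
      using Q(1) P(1) r by (intro mat_trace_comm[of _ d d]) auto
    also have "\<sigma> g * P * Q = \<sigma> g * (P * Q)" using Q(1) P(1) r by simp
    finally show ?thesis using Q r by simp
  qed
  then show "rep_char \<rho> = rep_char \<sigma>" by (auto simp: rep_char_def fun_eq_iff)
qed

lemma equiv_rep_equiv: "equiv {(d,\<rho>). is_irrep G d \<rho>} (rep_equiv G)"
proof (rule equivI)
  show "rep_equiv G \<subseteq> {(d,\<rho>). is_irrep G d \<rho>} \<times> {(d,\<rho>). is_irrep G d \<rho>}"
    by (auto simp: rep_equiv_def)
  show "refl_on {(d,\<rho>). is_irrep G d \<rho>} (rep_equiv G)"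
  proof (rule refl_onI, clarify)
    fix d \<rho> assume ir: "is_irrep G d \<rho>"
    have "1\<^sub>m d * \<rho> g = \<rho> g * 1\<^sub>m d" if "g \<in> carrier G" for g
      using is_repD(1)[OF is_irrepD(2)[OF ir] that] by simp
    moreover have "invertible_mat (1\<^sub>m d :: complex mat)" by (auto intro: invertible_matI[of _ d "1\<^sub>m d"])
    ultimately show "((d,\<rho>),(d,\<rho>)) \<in> rep_equiv G" using ir by (auto simp: rep_equiv_def intro!: bexI[of _ "1\<^sub>m d"])
  qed
  show "sym (rep_equiv G)"
  proof (rule symI, clarify)
    fix d \<rho> e \<sigma> assume "((d,\<rho>),(e,\<sigma>)) \<in> rep_equiv G"
    then obtain P where ir: "is_irrep G d \<rho>" "is_irrep G e \<sigma>" and de: "d = e"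
      and P: "P \<in> carrier_mat d d" "invertible_mat P" and tw: "\<And>g. g \<in> carrier G \<Longrightarrow> P * \<rho> g = \<sigma> g * P"
      by (auto simp: rep_equiv_def)
    obtain Q where Q: "Q \<in> carrier_mat d d" "P * Q = 1\<^sub>m d" "Q * P = 1\<^sub>m d" using invertible_matD[OF P(2,1)] .
    have "Q * \<sigma> g = \<rho> g * Q" if g: "g \<in> carrier G" for g
    proof -
      have r: "\<rho> g \<in> carrier_mat d d" "\<sigma> g \<in> carrier_mat d d"
        using is_repD(1)[OF is_irrepD(2)[OF ir(1)] g] is_repD(1)[OF is_irrepD(2)[OF ir(2)] g] de by auto
      have "Q * \<sigma> g = Q * \<sigma> g * (P * Q)" using Q r by (simp add: Q(2))
      also have "\<dots> = Q * (\<sigma> g * P) * Q" using Q(1) P(1) r by (simp add: assoc_mult_mat[of _ d d _ d _ d])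
      also have "\<dots> = (Q * P) * (\<rho> g * Q)"
        using Q(1) P(1) r unfolding tw[OF g, symmetric] by (simp add: assoc_mult_mat[of _ d d _ d _ d])
      finally show ?thesis using Q r by simp
    qed
    moreover have "invertible_mat Q" using invertible_matI[OF Q(1) P(1) Q(3,2)] .
    ultimately show "((e,\<sigma>),(d,\<rho>)) \<in> rep_equiv G" using ir de Q by (auto simp: rep_equiv_def)
  qed
  show "trans (rep_equiv G)"
  proof (rule transI, clarify)
    fix d \<rho> e \<sigma> f \<tau> assume a: "((d,\<rho>),(e,\<sigma>)) \<in> rep_equiv G" and b: "((e,\<sigma>),(f,\<tau>)) \<in> rep_equiv G"
    then have eqs: "e = d" "f = d" by (auto simp: rep_equiv_def)
    from a eqs obtain P where ir: "is_irrep G d \<rho>" "is_irrep G d \<sigma>"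
      and P: "P \<in> carrier_mat d d" "invertible_mat P" and tw: "\<And>g. g \<in> carrier G \<Longrightarrow> P * \<rho> g = \<sigma> g * P"
      by (auto simp: rep_equiv_def)
    from b eqs obtain P' where ir': "is_irrep G d \<tau>"
      and P': "P' \<in> carrier_mat d d" "invertible_mat P'" and tw': "\<And>g. g \<in> carrier G \<Longrightarrow> P' * \<sigma> g = \<tau> g * P'"
      by (auto simp: rep_equiv_def)
    obtain Q where Q: "Q \<in> carrier_mat d d" "P * Q = 1\<^sub>m d" "Q * P = 1\<^sub>m d" using invertible_matD[OF P(2,1)] .
    obtain Q' where Q': "Q' \<in> carrier_mat d d" "P' * Q' = 1\<^sub>m d" "Q' * P' = 1\<^sub>m d" using invertible_matD[OF P'(2,1)] .
    have "P' * P * (Q * Q') = P' * (P * Q) * Q'" "Q * Q' * (P' * P) = Q * (Q' * P') * P"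
      using P(1) P'(1) Q(1) Q'(1) by (simp_all add: assoc_mult_mat[of _ d d _ d _ d])
    then have "P' * P * (Q * Q') = 1\<^sub>m d" "Q * Q' * (P' * P) = 1\<^sub>m d"
      using P(1) P'(1) Q Q' by simp_all
    then have "invertible_mat (P' * P)"
      using P(1) P'(1) Q(1) Q'(1) by (intro invertible_matI[of _ d "Q * Q'"]) auto
    moreover have "P' * P * \<rho> g = \<tau> g * (P' * P)" if g: "g \<in> carrier G" for g
    proof -
      have r: "\<rho> g \<in> carrier_mat d d" "\<sigma> g \<in> carrier_mat d d" "\<tau> g \<in> carrier_mat d d"
        using is_repD(1)[OF is_irrepD(2)[OF ir(1)] g] is_repD(1)[OF is_irrepD(2)[OF ir(2)] g]
          is_repD(1)[OF is_irrepD(2)[OF ir'] g] by auto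
      have "P' * P * \<rho> g = P' * (\<sigma> g * P)" using P(1) P'(1) r by (simp add: tw[OF g])
      also have "\<dots> = (P' * \<sigma> g) * P" using P(1) P'(1) r by simp
      also have "\<dots> = \<tau> g * (P' * P)" using P(1) P'(1) r by (simp add: tw'[OF g])
      finally show ?thesis .
    qed
    ultimately show "((d,\<rho>),(f,\<tau>)) \<in> rep_equiv G"
      using ir ir' P P' eqs by (auto simp: rep_equiv_def intro!: bexI[of _ "P' * P"])
  qed
qed

text \<open>Left translation permutes the points of G, and g fixes one of them only if g = 1. The
  trace of the permutation matrix is therefore |G| at 1 and 0 elsewhere, which is the convolution
  unit with no rescaling.\<close>

lemma regular_rep:
  obtains d \<rho> where "is_rep G d \<rho>" "rep_char \<rho> = L1_unit G"
proof -
  let ?n = "card (carrier G)"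
  obtain e where e: "bij_betw e {0..<?n} (carrier G)" using ex_bij_betw_nat_finite[OF fin] by blast
  then have eG: "e i \<in> carrier G" if "i < ?n" for i using that by (auto simp: bij_betw_def)
  have einj: "e i = e j \<longleftrightarrow> i = j" if "i < ?n" "j < ?n" for i j
    using e that by (auto simp: bij_betw_def inj_on_def)
  define \<rho> where "\<rho> g = mat ?n ?n (\<lambda>(i,j). if e i = g \<otimes> e j then 1 else 0 :: complex)" for g
  have "\<rho> (g \<otimes> h) = \<rho> g * \<rho> h" if gh: "g \<in> carrier G" "h \<in> carrier G" for g h
  proof (rule eq_matI)
    fix i j assume "i < dim_row (\<rho> g * \<rho> h)" "j < dim_col (\<rho> g * \<rho> h)"
    then have ij: "i < ?n" "j < ?n" by (auto simp: \<rho>_def)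
    have "(\<rho> g * \<rho> h) $$ (i,j) = (\<Sum>l\<in>{0..<?n}. (if e i = g \<otimes> e l then 1 else 0) * (if e l = h \<otimes> e j then 1 else 0))"
      using ij by (simp add: \<rho>_def scalar_prod_def)
    also have "\<dots> = (\<Sum>x\<in>carrier G. (if e i = g \<otimes> x then 1 else 0) * (if x = h \<otimes> e j then 1 else 0))"
      using sum.reindex_bij_betw[OF e, of "\<lambda>x. (if e i = g \<otimes> x then 1 else 0) * (if x = h \<otimes> e j then 1 else 0)"] .
    also have "\<dots> = (\<Sum>x\<in>carrier G. if x = h \<otimes> e j then (if e i = g \<otimes> x then 1 else 0) else 0)"
      by (intro sum.cong) auto
    also have "\<dots> = (if e i = g \<otimes> (h \<otimes> e j) then 1 else 0)"
      using fin gh eG[OF ij(2)] by simp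
    finally show "\<rho> (g \<otimes> h) $$ (i,j) = (\<rho> g * \<rho> h) $$ (i,j)"
      using ij gh eG by (simp add: \<rho>_def m_assoc)
  qed (auto simp: \<rho>_def)
  moreover have "\<rho> \<one> = 1\<^sub>m ?n" by (intro eq_matI) (auto simp: \<rho>_def eG einj)
  ultimately have r: "is_rep G ?n \<rho>" by (auto simp: is_rep_def) (auto simp: \<rho>_def)
  have "rep_char \<rho> g = L1_unit G g" for g
  proof (cases "g \<in> carrier G")
    case True
    have "rep_char \<rho> g = (\<Sum>i<?n. if e i = g \<otimes> e i then 1 else 0)"
      unfolding rep_char_eq[OF r True] by (intro sum.cong) (auto simp: \<rho>_def)
    also have "\<dots> = (\<Sum>i<?n. if g = \<one> then 1 else 0)"
      using True eG by (intro sum.cong) auto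
    finally show ?thesis by (simp add: L1_unit_def)
  qed (auto simp: rep_char_def L1_unit_def)
  then show thesis using that r by blast
qed

lemma L1_unit_sum_of_irreps:
  obtains n :: nat and D R where "\<And>i. i < n \<Longrightarrow> is_irrep G (D i) (R i)"
    "L1_unit G = (\<lambda>g. \<Sum>i<n. rep_char (R i) g)"
proof -
  obtain d \<rho> where r: "is_rep G d \<rho>" "rep_char \<rho> = L1_unit G" using regular_rep .
  obtain xs where ir: "\<forall>(e,\<sigma>)\<in>set xs. is_irrep G e \<sigma>"
    and tr: "\<forall>g\<in>carrier G. mat_trace (\<rho> g) = (\<Sum>(e,\<sigma>)\<leftarrow>xs. mat_trace (\<sigma> g))"
    using character_sum_of_irreps[OF is_group r(1)] by blast
  have "L1_unit G g = (\<Sum>i<length xs. rep_char (snd (xs ! i)) g)" for g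
    using tr unfolding r(2)[symmetric]
    by (auto simp: rep_char_def sum_list_sum_nth atLeast0LessThan case_prod_beta)
  moreover have "is_irrep G (fst (xs ! i)) (snd (xs ! i))" if "i < length xs" for i
    using ir nth_mem[OF that] by auto
  ultimately show thesis by (intro that[of "length xs" "\<lambda>i. fst (xs ! i)" "\<lambda>i. snd (xs ! i)"]) auto
qed

section \<open>The convolution algebra and its centre\<close>

lemma conv_sum_right: "conv G f (\<lambda>s. \<Sum>i\<in>I. h i s) = (\<lambda>s. \<Sum>i\<in>I. conv G f (h i) s)"
  by (rule ext) (auto simp: conv_def sum_distrib_left sum_divide_distrib intro: sum.swap)

lemma conv_sum_left: "conv G (\<lambda>s. \<Sum>i\<in>I. h i s) f = (\<lambda>s. \<Sum>i\<in>I. conv G (h i) f s)"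
  by (rule ext) (auto simp: conv_def sum_distrib_right sum_divide_distrib intro: sum.swap)

lemma conv_cmult_left: "conv G (\<lambda>s. c * f s) g = (\<lambda>s. c * conv G f g s)"
  by (rule ext) (auto simp: conv_def sum_distrib_left mult.assoc)

lemma conv_cmult_right: "conv G f (\<lambda>s. c * g s) = (\<lambda>s. c * conv G f g s)"
  by (rule ext) (auto simp: conv_def sum_distrib_left mult.left_commute)

lemma conv_diff_left: "conv G (\<lambda>s. f s - h s) g = (\<lambda>s. conv G f g s - conv G h g s)"
  by (rule ext) (auto simp: conv_def sum_subtractf diff_divide_distrib left_diff_distrib)

lemma conv_L1 [simp]: "conv G f g \<in> L1 G"
  by (simp add: conv_def L1_def)

lemma conv_unit_right:
  assumes "f \<in> L1 G" shows "conv G f (L1_unit G) = f"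
proof
  fix s
  show "conv G f (L1_unit G) s = f s"
  proof (cases "s \<in> carrier G")
    case True
    have "(\<Sum>t\<in>carrier G. f t * L1_unit G (inv t \<otimes> s)) = (\<Sum>t\<in>carrier G. if t = s then f t * of_nat (card (carrier G)) else 0)"
    proof (intro sum.cong refl)
      fix t assume t: "t \<in> carrier G"
      have "inv t \<otimes> s = \<one> \<longleftrightarrow> t = s"
        using t True by (metis inv_closed inv_inv inv_equality l_inv)
      then show "f t * L1_unit G (inv t \<otimes> s) = (if t = s then f t * of_nat (card (carrier G)) else 0)"
        by (simp add: L1_unit_def)
    qed
    then show ?thesis using True fin card_pos by (auto simp: conv_def)
  qed (use assms in \<open>simp add: conv_def L1_def\<close>)
qed

lemma conv_assoc: "conv G (conv G f g) h = conv G f (conv G g h)"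
proof
  fix s
  let ?N = "of_nat (card (carrier G)) :: complex"
  show "conv G (conv G f g) h s = conv G f (conv G g h) s"
  proof (cases "s \<in> carrier G")
    case True
    have "(\<Sum>t\<in>carrier G. conv G f g t * h (inv t \<otimes> s))
        = (\<Sum>u\<in>carrier G. \<Sum>t\<in>carrier G. f u * g (inv u \<otimes> t) * h (inv t \<otimes> s)) / ?N"
      by (subst sum.swap) (simp add: conv_def sum_divide_distrib sum_distrib_right)
    also have "(\<Sum>u\<in>carrier G. \<Sum>t\<in>carrier G. f u * g (inv u \<otimes> t) * h (inv t \<otimes> s))
        = (\<Sum>u\<in>carrier G. \<Sum>v\<in>carrier G. f u * g v * h (inv v \<otimes> (inv u \<otimes> s)))"
    proof (rule sum.cong[OF refl])
      fix u assume u: "u \<in> carrier G"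
      have "(\<Sum>t\<in>carrier G. f u * g (inv u \<otimes> t) * h (inv t \<otimes> s))
          = (\<Sum>v\<in>carrier G. f u * g (inv u \<otimes> (u \<otimes> v)) * h (inv (u \<otimes> v) \<otimes> s))"
        using sum_lmult[OF u, of "\<lambda>t. f u * g (inv u \<otimes> t) * h (inv t \<otimes> s)"] by simp
      also have "\<dots> = (\<Sum>v\<in>carrier G. f u * g v * h (inv v \<otimes> (inv u \<otimes> s)))"
        using u True by (intro sum.cong refl) (simp add: inv_mult_group m_assoc flip: m_assoc[of "inv u" u])
      finally show "(\<Sum>t\<in>carrier G. f u * g (inv u \<otimes> t) * h (inv t \<otimes> s))
          = (\<Sum>v\<in>carrier G. f u * g v * h (inv v \<otimes> (inv u \<otimes> s)))" .
    qed
    also have "\<dots> / ?N = (\<Sum>u\<in>carrier G. f u * conv G g h (inv u \<otimes> s))"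
      using True by (simp add: conv_def sum_divide_distrib sum_distrib_left mult.assoc)
    finally show ?thesis using True by (simp add: conv_def[of G "conv G f g"] conv_def[of G f "conv G g h"])
  qed (simp add: conv_def)
qed

lemma ZL1_L1: "f \<in> ZL1 G \<Longrightarrow> f \<in> L1 G"
  by (simp add: ZL1_def)

lemma ZL1_conv:
  assumes "f \<in> ZL1 G" "g \<in> ZL1 G"
  shows "conv G f g \<in> ZL1 G"
proof -
  have "conv G (conv G f g) k = conv G k (conv G f g)" if k: "k \<in> L1 G" for k
  proof -
    have "conv G (conv G f g) k = conv G f (conv G k g)" using conv_commute[OF assms(2) k] by (simp add: conv_assoc)
    also have "\<dots> = conv G (conv G k f) g" using conv_commute[OF assms(1) k] by (simp flip: conv_assoc)
    finally show ?thesis by (simp add: conv_assoc)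
  qed
  then show ?thesis by (simp add: ZL1_def)
qed

lemma ZL1_sum: "(\<And>i. i \<in> I \<Longrightarrow> f i \<in> ZL1 G) \<Longrightarrow> (\<lambda>s. \<Sum>i\<in>I. f i s) \<in> ZL1 G"
  by (auto simp: ZL1_iff L1_def intro!: sum.cong)

lemma ZL1_cmult: "f \<in> ZL1 G \<Longrightarrow> (\<lambda>s. c * f s) \<in> ZL1 G"
  by (auto simp: ZL1_iff L1_def)

lemma ZL1_diff: "f \<in> ZL1 G \<Longrightarrow> g \<in> ZL1 G \<Longrightarrow> (\<lambda>s. f s - g s) \<in> ZL1 G"
  by (auto simp: ZL1_iff L1_def)

text \<open>The same choice is made in \<open>dim_of\<close> and \<open>character\<close>, so
  \<open>(dim_of \<pi>, irr \<pi>)\<close> is the one pair that all of them select.\<close>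

definition irr :: "(nat \<times> ('a \<Rightarrow> complex mat)) set \<Rightarrow> 'a \<Rightarrow> complex mat" where
  "irr \<pi> = snd (SOME p. p \<in> \<pi>)"

definition idem :: "(nat \<times> ('a \<Rightarrow> complex mat)) set \<Rightarrow> 'a \<Rightarrow> complex" where
  "idem \<pi> = (\<lambda>s. of_nat (dim_of \<pi>) * rep_char (irr \<pi>) s)"

lemma dual_representative:
  assumes "\<pi> \<in> dual G"
  shows "is_irrep G (dim_of \<pi>) (irr \<pi>)" "\<pi> = rep_equiv G `` {(dim_of \<pi>, irr \<pi>)}"
proof -
  let ?A = "{(d,\<rho>). is_irrep G d \<rho>}"
  let ?p = "SOME p. p \<in> \<pi>"
  have pi: "\<pi> \<in> ?A // rep_equiv G" using assms by (simp add: dual_def)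
  then have "\<pi> \<noteq> {}" using in_quotient_imp_non_empty[OF equiv_rep_equiv] by metis
  then have p: "?p \<in> \<pi>" by (simp add: some_in_eq)
  have eq: "?p = (dim_of \<pi>, irr \<pi>)" by (simp add: dim_of_def irr_def)
  have "?p \<in> ?A" using subsetD[OF in_quotient_imp_subset[OF equiv_rep_equiv pi] p] .
  then show "is_irrep G (dim_of \<pi>) (irr \<pi>)" unfolding eq by simp
  show "\<pi> = rep_equiv G `` {(dim_of \<pi>, irr \<pi>)}"
  proof -
    obtain x where x: "\<pi> = rep_equiv G `` {x}" using pi by (rule quotientE)
    have "(x, ?p) \<in> rep_equiv G" using p x by blast
    then have "rep_equiv G `` {x} = rep_equiv G `` {?p}" by (rule equiv_class_eq[OF equiv_rep_equiv])
    from trans[OF x this] show ?thesis unfolding eq .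
  qed
qed

text \<open>The representative selected from the class of \<open>\<rho>\<close> may differ from
  \<open>\<rho>\<close>; an equivalence is all that can be asserted, and it suffices for
  characters.\<close>

lemma dual_class:
  assumes "is_irrep G d \<rho>"
  obtains \<pi> where "\<pi> \<in> dual G" "((d,\<rho>),(dim_of \<pi>, irr \<pi>)) \<in> rep_equiv G"
proof -
  let ?\<pi> = "rep_equiv G `` {(d,\<rho>)}"
  have pi: "?\<pi> \<in> dual G" unfolding dual_def using assms by (intro quotientI) auto
  have "((dim_of ?\<pi>, irr ?\<pi>), (dim_of ?\<pi>, irr ?\<pi>)) \<in> rep_equiv G"
    using equiv_rep_equiv dual_representative(1)[OF pi] by (auto simp: equiv_def refl_on_def)
  then have "(dim_of ?\<pi>, irr ?\<pi>) \<in> ?\<pi>" using dual_representative(2)[OF pi] by blast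
  then show thesis using that pi by blast
qed

lemma dual_inequivalent:
  assumes "\<pi> \<in> dual G" "\<pi>' \<in> dual G" "\<pi> \<noteq> \<pi>'"
  shows "((dim_of \<pi>, irr \<pi>), (dim_of \<pi>', irr \<pi>')) \<notin> rep_equiv G"
  using dual_representative(2)[OF assms(1)] dual_representative(2)[OF assms(2)] assms(3)
    equiv_class_eq[OF equiv_rep_equiv] by metis

text \<open>Every irreducible representation is equivalent to one of the finitely many constituents
  of the regular character: otherwise chi = chi * unit would be 0 by orthogonality, against chi(1) =
  d > 0.\<close>

lemma finite_dual: "finite (dual G)"
proof -
  obtain n D R where ir: "\<And>i. i < n \<Longrightarrow> is_irrep G (D i) (R i)"
    and unit: "L1_unit G = (\<lambda>g. \<Sum>i<(n::nat). rep_char (R i) g)"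
    using L1_unit_sum_of_irreps by metis
  have "dual G \<subseteq> (\<lambda>i. rep_equiv G `` {(D i, R i)}) ` {..<n}"
  proof
    fix \<pi> assume pi: "\<pi> \<in> dual G"
    note ip = dual_representative(1)[OF pi]
    have "\<exists>i<n. ((D i, R i), (dim_of \<pi>, irr \<pi>)) \<in> rep_equiv G"
    proof (rule ccontr)
      assume no: "\<not> ?thesis"
      have "rep_char (irr \<pi>) = conv G (rep_char (irr \<pi>)) (L1_unit G)"
        using conv_unit_right[OF ZL1_L1[OF rep_char_ZL1[OF is_irrepD(2)[OF ip]]]] by simp
      also have "\<dots> = (\<lambda>s. 0)"
        using no unfolding unit by (auto simp: conv_sum_right conv_char_inequivalent[OF ir ip])
      finally show False using rep_char_one[OF is_irrepD(2)[OF ip]] is_irrepD(1)[OF ip] by simp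
    qed
    then obtain i where "i < n" "((D i, R i), (dim_of \<pi>, irr \<pi>)) \<in> rep_equiv G" by blast
    then show "\<pi> \<in> (\<lambda>i. rep_equiv G `` {(D i, R i)}) ` {..<n}"
      using dual_representative(2)[OF pi] equiv_class_eq[OF equiv_rep_equiv] by blast
  qed
  then show ?thesis by (rule finite_subset) simp
qed

lemma idem_ZL1: "\<pi> \<in> dual G \<Longrightarrow> idem \<pi> \<in> ZL1 G"
  unfolding idem_def using ZL1_cmult rep_char_ZL1 is_irrepD(2) dual_representative(1) by blast

lemma conv_idem_self:
  assumes "\<pi> \<in> dual G" shows "conv G (idem \<pi>) (idem \<pi>) = idem \<pi>"
  using is_irrepD(1)[OF dual_representative(1)[OF assms]]
  by (simp add: idem_def conv_cmult_left conv_cmult_right conv_char_self[OF dual_representative(1)[OF assms]])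

lemma conv_idem_eigen:
  assumes "\<pi> \<in> dual G" "f \<in> ZL1 G"
  shows "\<exists>c. conv G f (idem \<pi>) = (\<lambda>s. c * idem \<pi> s)"
proof -
  obtain c where "conv G f (rep_char (irr \<pi>)) = (\<lambda>s. c * rep_char (irr \<pi>) s)"
    using conv_rep_char_eigen[OF dual_representative(1)[OF assms(1)] assms(2)] .
  then show ?thesis by (intro exI[of _ c]) (simp add: idem_def conv_cmult_right mult.left_commute)
qed

lemma sum_idem: "(\<lambda>s. \<Sum>\<pi>\<in>dual G. idem \<pi> s) = L1_unit G"
proof -
  \<comment> \<open>\<open>f\<close> is the defect to be shown zero. By \<open>zero\<close> it
    annihilates every irreducible character, hence also their sum, the unit.\<close>
  define f where "f = (\<lambda>s. L1_unit G s - (\<Sum>\<pi>\<in>dual G. idem \<pi> s))"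
  have zero: "conv G f (rep_char \<rho>) = (\<lambda>s. 0)" if ir: "is_irrep G d \<rho>" for d \<rho>
  proof -
    obtain \<pi> where pi: "\<pi> \<in> dual G" "((d,\<rho>),(dim_of \<pi>, irr \<pi>)) \<in> rep_equiv G" using dual_class[OF ir] .
    note ip = dual_representative(1)[OF pi(1)]
    let ?\<chi> = "rep_char (irr \<pi>)"
    have chi: "rep_char \<rho> = ?\<chi>" using rep_char_rep_equiv[OF pi(2)] .
    have Z: "?\<chi> \<in> ZL1 G" using rep_char_ZL1[OF is_irrepD(2)[OF ip]] .
    have L: "L1_unit G \<in> L1 G" by (auto simp: L1_unit_def L1_def)
    have "conv G (L1_unit G) ?\<chi> = ?\<chi>"
      using conv_unit_right[OF ZL1_L1[OF Z]] conv_commute[OF Z L] by simp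
    moreover have "(\<Sum>\<pi>'\<in>dual G. conv G (idem \<pi>') ?\<chi> s) = ?\<chi> s" for s
    proof -
      \<comment> \<open>For the matching class the weight d cancels the factor 1/d from chi *
        chi.\<close>
      have "conv G (idem \<pi>') ?\<chi> s = (if \<pi>' = \<pi> then ?\<chi> s else 0)" if "\<pi>' \<in> dual G" for \<pi>'
        using conv_char_inequivalent[OF ip dual_representative(1)[OF that] dual_inequivalent[OF pi(1) that]]
          conv_char_self[OF ip] is_irrepD(1)[OF ip] by (auto simp: idem_def conv_cmult_left)
      then show ?thesis using finite_dual pi(1) by simp
    qed
    ultimately show ?thesis unfolding f_def chi by (simp add: conv_diff_left conv_sum_left)
  qed
  obtain n D R where ir: "\<And>i. i < n \<Longrightarrow> is_irrep G (D i) (R i)"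
    and unit: "L1_unit G = (\<lambda>g. \<Sum>i<(n::nat). rep_char (R i) g)"
    using L1_unit_sum_of_irreps by metis
  have "f \<in> L1 G"
    using idem_ZL1 by (auto simp: f_def L1_def L1_unit_def ZL1_def intro!: sum.neutral)
  then have "f = conv G f (L1_unit G)" using conv_unit_right by simp
  also have "\<dots> = (\<lambda>s. 0)" unfolding unit by (simp add: conv_sum_right zero[OF ir])
  finally show ?thesis by (simp add: f_def fun_eq_iff)
qed

section \<open>The tensor square of the centre\<close>

lemma conj_class_refl: "x \<in> carrier G \<Longrightarrow> x \<in> conj_class G x"
  by (auto simp: conj_class_def intro!: exI[of _ \<one>])

lemma conj_class_carrier: "x \<in> carrier G \<Longrightarrow> conj_class G x \<subseteq> carrier G"
  by (auto simp: conj_class_def)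

lemma conj_class_eq:
  assumes x: "x \<in> carrier G" and y: "y \<in> conj_class G x"
  shows "conj_class G y = conj_class G x"
proof -
  obtain g where g: "g \<in> carrier G" "y = g \<otimes> x \<otimes> inv g" using y by (auto simp: conj_class_def)
  have "h \<otimes> y \<otimes> inv h = (h \<otimes> g) \<otimes> x \<otimes> inv (h \<otimes> g)" if "h \<in> carrier G" for h
    using that g x by (simp add: inv_mult_group m_assoc)
  moreover have "h \<otimes> x \<otimes> inv h = (h \<otimes> inv g) \<otimes> y \<otimes> inv (h \<otimes> inv g)" if "h \<in> carrier G" for h
  proof -
    have "inv g \<otimes> (g \<otimes> z) = z" if "z \<in> carrier G" for z using that g by (simp flip: m_assoc)
    then show ?thesis using that g x by (simp add: inv_mult_group m_assoc)
  qed
  ultimately show ?thesis using g(1) unfolding conj_class_def by (blast intro: m_closed inv_closed)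
qed

lemma ZL1_conj_class:
  assumes "f \<in> ZL1 G" "x \<in> carrier G" "y \<in> conj_class G x"
  shows "f y = f x"
proof -
  obtain g where g: "g \<in> carrier G" "y = g \<otimes> x \<otimes> inv g" using assms(3) by (auto simp: conj_class_def)
  then have "f y = f (inv g \<otimes> (g \<otimes> x))" using assms by (simp add: ZL1_iff)
  then show ?thesis using g assms(2) by (simp flip: m_assoc)
qed

lemma Conj_rep:
  assumes "C \<in> Conj G"
  shows "(SOME g. g \<in> C) \<in> C" "(SOME g. g \<in> C) \<in> carrier G" "conj_class G (SOME g. g \<in> C) = C"
proof -
  obtain x where x: "x \<in> carrier G" "C = conj_class G x" using assms by (auto simp: Conj_def)
  then show *: "(SOME g. g \<in> C) \<in> C" using conj_class_refl by (metis some_in_eq empty_iff)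
  then show "(SOME g. g \<in> C) \<in> carrier G" using conj_class_carrier x by blast
  show "conj_class G (SOME g. g \<in> C) = C" using conj_class_eq[OF x(1)] * x(2) by blast
qed

lemma finite_Conj: "finite (Conj G)"
  using fin by (simp add: Conj_def)

lemma sum_Conj:
  fixes F :: "'a \<Rightarrow> real"
  assumes "\<And>x y. x \<in> carrier G \<Longrightarrow> y \<in> conj_class G x \<Longrightarrow> F y = F x"
  shows "(\<Sum>s\<in>carrier G. F s) = (\<Sum>C\<in>Conj G. real (card C) * F (SOME g. g \<in> C))"
proof -
  have "(\<Sum>s\<in>carrier G. F s) = (\<Sum>C\<in>Conj G. \<Sum>s\<in>{x. x \<in> carrier G \<and> conj_class G x = C}. F s)"
    using sum.group[OF fin finite_Conj, of "conj_class G" F] by (simp add: Conj_def)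
  also have "\<dots> = (\<Sum>C\<in>Conj G. real (card C) * F (SOME g. g \<in> C))"
  proof (rule sum.cong[OF refl])
    fix C assume C: "C \<in> Conj G"
    let ?c = "SOME g. g \<in> C"
    note c = Conj_rep[OF C]
    have "{x. x \<in> carrier G \<and> conj_class G x = C} = C"
      using conj_class_refl conj_class_carrier[OF c(2)] conj_class_eq[OF c(2)] c(3) by blast
    moreover have "F s = F ?c" if "s \<in> C" for s using assms[OF c(2), of s] c(3) that by simp
    ultimately show "(\<Sum>s\<in>{x. x \<in> carrier G \<and> conj_class G x = C}. F s) = real (card C) * F ?c" by simp
  qed
  finally show ?thesis .
qed

section \<open>The projective norm as an L1 norm\<close>

text \<open>The norm of L1(G x G) for the product of the two normalised Haar measures, hence the
  square in the denominator.\<close>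

definition l1_norm2 :: "('a \<times> 'a \<Rightarrow> complex) \<Rightarrow> real" where
  "l1_norm2 u = (\<Sum>s\<in>carrier G. \<Sum>t\<in>carrier G. cmod (u (s,t))) / (real (card (carrier G)))\<^sup>2"

text \<open>Writing \<open>u\<close> as the sum of the indicator functions of the conjugacy classes tensored with the
  slices of \<open>u\<close> attains the projective norm.\<close>
lemma class_indicator_representation:
  assumes u1: "\<And>t. (\<lambda>s. u (s,t)) \<in> ZL1 G" and u2: "\<And>s. (\<lambda>t. u (s,t)) \<in> ZL1 G"
  obtains n a b where "(n, a, b) \<in> tensor_reps (ZL1 G) u"
    "(\<Sum>i<n. L1_norm G (a i) * L1_norm G (b i)) = l1_norm2 u"
proof -
  let ?N = "real (card (carrier G))"
  let ?n = "card (Conj G)"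
  obtain e where "bij_betw e {0..<?n} (Conj G)" using ex_bij_betw_nat_finite[OF finite_Conj] by blast
  then have e: "bij_betw e {..<?n} (Conj G)" by (simp add: atLeast0LessThan)
  define ind where "ind C s = (if s \<in> C then 1 else 0 :: complex)" for C and s :: 'a
  define sl where "sl C t = u (SOME g. g \<in> C, t)" for C t
  have eC: "e i \<in> Conj G" if "i < ?n" for i using e that by (auto simp: bij_betw_def)
  have ind: "ind C \<in> ZL1 G" if C: "C \<in> Conj G" for C
    unfolding ZL1_iff
  proof (intro conjI ballI)
    have CG: "C \<subseteq> carrier G" using conj_class_carrier[OF Conj_rep(2)[OF C]] Conj_rep(3)[OF C] by simp
    then show "ind C \<in> L1 G" by (auto simp: L1_def ind_def)
    fix x y assume xy: "x \<in> carrier G" "y \<in> carrier G"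
    have "x \<otimes> y = x \<otimes> (y \<otimes> x) \<otimes> inv x" using xy by (simp add: m_assoc)
    then have "x \<otimes> y \<in> conj_class G (y \<otimes> x)" using xy by (auto simp: conj_class_def)
    then have eq: "conj_class G (x \<otimes> y) = conj_class G (y \<otimes> x)" using xy conj_class_eq by blast
    have "z \<in> C \<longleftrightarrow> conj_class G z = C" if "z \<in> carrier G" for z
      using that conj_class_refl conj_class_eq[OF Conj_rep(2)[OF C]] Conj_rep(3)[OF C] by blast
    then show "ind C (x \<otimes> y) = ind C (y \<otimes> x)" using xy eq by (simp add: ind_def)
  qed
  have decomp: "u (s,t) = (\<Sum>i<?n. ind (e i) s * sl (e i) t)" for s t
  proof -
    have "(\<Sum>i<?n. ind (e i) s * sl (e i) t) = (\<Sum>C\<in>Conj G. ind C s * sl C t)"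
      using sum.reindex_bij_betw[OF e, of "\<lambda>C. ind C s * sl C t"] .
    also have "\<dots> = u (s,t)"
    proof (cases "s \<in> carrier G")
      case True
      let ?C = "conj_class G s"
      have C: "?C \<in> Conj G" using True by (simp add: Conj_def)
      have "(\<Sum>C\<in>Conj G. ind C s * sl C t) = (\<Sum>C\<in>Conj G. if C = ?C then sl C t else 0)"
      proof (rule sum.cong[OF refl])
        fix C assume "C \<in> Conj G"
        from Conj_rep[OF this] have "s \<in> C \<longleftrightarrow> C = ?C"
          using conj_class_refl[OF True] conj_class_eq by blast
        then show "ind C s * sl C t = (if C = ?C then sl C t else 0)" by (simp add: ind_def)
      qed
      also have "\<dots> = sl ?C t" using C finite_Conj by simp
      also have "\<dots> = u (s,t)"
        using ZL1_conj_class[OF u1 True Conj_rep(1)[OF C]] by (simp add: sl_def)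
      finally show ?thesis .
    next
      case False
      then have "u (s,t) = 0" using u1[of t] by (simp add: ZL1_def L1_def)
      moreover have "ind C s = 0" if "C \<in> Conj G" for C
        using ind[OF that] False by (simp add: ZL1_def L1_def)
      ultimately show ?thesis by simp
    qed
    finally show ?thesis by simp
  qed
  have "u = (\<lambda>p. \<Sum>i<?n. tensor (ind (e i)) (sl (e i)) p)"
  proof
    fix p show "u p = (\<Sum>i<?n. tensor (ind (e i)) (sl (e i)) p)"
      using decomp[of "fst p" "snd p"] by (simp only: tensor_def case_prod_beta prod.collapse)
  qed
  moreover have "sl C \<in> ZL1 G" for C unfolding sl_def by (rule u2)
  ultimately have "(?n, \<lambda>i. ind (e i), \<lambda>i. sl (e i)) \<in> tensor_reps (ZL1 G) u"
    using ind eC by (simp only: tensor_reps_def mem_Collect_eq case_prod_conv) blast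
  \<comment> \<open>The indicators have disjoint supports, so no cancellation occurs between the
    terms. Each has norm card C / |G|, and weighting the slices by class sizes restores the sum over
    all s.\<close>
  moreover have "(\<Sum>i<?n. L1_norm G (ind (e i)) * L1_norm G (sl (e i))) = l1_norm2 u"
  proof -
    have "(\<Sum>i<?n. L1_norm G (ind (e i)) * L1_norm G (sl (e i))) = (\<Sum>C\<in>Conj G. L1_norm G (ind C) * L1_norm G (sl C))"
      using sum.reindex_bij_betw[OF e, of "\<lambda>C. L1_norm G (ind C) * L1_norm G (sl C)"] .
    also have "\<dots> = (\<Sum>C\<in>Conj G. real (card C) * (\<Sum>t\<in>carrier G. cmod (u (SOME g. g \<in> C, t))) / ?N\<^sup>2)"
    proof (rule sum.cong[OF refl])
      fix C assume C: "C \<in> Conj G"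
      have CG: "C \<subseteq> carrier G" using conj_class_carrier[OF Conj_rep(2)[OF C]] Conj_rep(3)[OF C] by simp
      have "(\<Sum>s\<in>carrier G. cmod (ind C s)) = (\<Sum>s\<in>C. 1)"
        using CG fin by (intro sum.mono_neutral_cong_right) (auto simp: ind_def)
      then show "L1_norm G (ind C) * L1_norm G (sl C)
          = real (card C) * (\<Sum>t\<in>carrier G. cmod (u (SOME g. g \<in> C, t))) / ?N\<^sup>2"
        by (simp add: L1_norm_def sl_def power2_eq_square)
    qed
    also have "\<dots> = (\<Sum>s\<in>carrier G. \<Sum>t\<in>carrier G. cmod (u (s,t))) / ?N\<^sup>2"
      unfolding sum_divide_distrib[symmetric]
      by (subst sum_Conj[of "\<lambda>s. \<Sum>t\<in>carrier G. cmod (u (s,t))"])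
        (auto intro!: sum.cong arg_cong[where f = cmod] dest: ZL1_conj_class[OF u1])
    finally show ?thesis by (simp add: l1_norm2_def)
  qed
  ultimately show thesis by (rule that)
qed

text \<open>From right to left, the expansion in class indicators writes a function that is central
  in each variable as a finite sum of elementary tensors. Membership can then be checked slice by
  slice.\<close>

lemma ZL1_tensor_iff:
  "u \<in> ZL1_tensor G \<longleftrightarrow> (\<forall>t. (\<lambda>s. u (s,t)) \<in> ZL1 G) \<and> (\<forall>s. (\<lambda>t. u (s,t)) \<in> ZL1 G)"
proof
  assume "u \<in> ZL1_tensor G"
  then obtain n a b where "(n, a, b) \<in> tensor_reps (ZL1 G) u" by (auto simp: ZL1_tensor_def)
  then have ab: "\<And>i. i < n \<Longrightarrow> a i \<in> ZL1 G" "\<And>i. i < n \<Longrightarrow> b i \<in> ZL1 G"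
    and u: "\<And>s t. u (s,t) = (\<Sum>i<n. a i s * b i t)"
    by (auto simp: tensor_reps_def tensor_def)
  have "(\<lambda>s. u (s,t)) \<in> ZL1 G" for t
    unfolding u using ab by (subst mult.commute) (auto intro!: ZL1_sum ZL1_cmult)
  moreover have "(\<lambda>t. u (s,t)) \<in> ZL1 G" for s
    unfolding u using ab by (auto intro!: ZL1_sum ZL1_cmult)
  ultimately show "(\<forall>t. (\<lambda>s. u (s,t)) \<in> ZL1 G) \<and> (\<forall>s. (\<lambda>t. u (s,t)) \<in> ZL1 G)" by blast
next
  assume u: "(\<forall>t. (\<lambda>s. u (s,t)) \<in> ZL1 G) \<and> (\<forall>s. (\<lambda>t. u (s,t)) \<in> ZL1 G)"
  show "u \<in> ZL1_tensor G"
    by (rule class_indicator_representation[of u]) (use u in \<open>auto simp: ZL1_tensor_def\<close>)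
qed

text \<open>By the triangle inequality, and because the double sum of each elementary tensor
  factorises.\<close>

lemma l1_norm2_le_representation:
  assumes "(n, a, b) \<in> tensor_reps (ZL1 G) u"
  shows "l1_norm2 u \<le> (\<Sum>i<n. L1_norm G (a i) * L1_norm G (b i))"
proof -
  have u: "\<And>s t. u (s,t) = (\<Sum>i<n. a i s * b i t)"
    using assms by (auto simp: tensor_reps_def tensor_def)
  have "(\<Sum>s\<in>carrier G. \<Sum>t\<in>carrier G. cmod (u (s,t)))
      \<le> (\<Sum>s\<in>carrier G. \<Sum>t\<in>carrier G. \<Sum>i<n. cmod (a i s) * cmod (b i t))"
    unfolding u by (intro sum_mono order_trans[OF norm_sum]) (simp add: norm_mult)
  also have "\<dots> = (\<Sum>s\<in>carrier G. \<Sum>i<n. \<Sum>t\<in>carrier G. cmod (a i s) * cmod (b i t))"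
    by (rule sum.cong[OF refl], rule sum.swap)
  also have "\<dots> = (\<Sum>i<n. \<Sum>s\<in>carrier G. \<Sum>t\<in>carrier G. cmod (a i s) * cmod (b i t))"
    by (rule sum.swap)
  also have "\<dots> = (\<Sum>i<n. (\<Sum>s\<in>carrier G. cmod (a i s)) * (\<Sum>t\<in>carrier G. cmod (b i t)))"
    by (simp add: sum_product)
  finally show ?thesis
    using card_pos by (simp add: l1_norm2_def L1_norm_def power2_eq_square divide_right_mono
        flip: sum_divide_distrib)
qed

lemma proj_norm_eq:
  assumes "u \<in> ZL1_tensor G"
  shows "proj_norm G u = l1_norm2 u"
  unfolding proj_norm_def
proof (rule cInf_eq_minimum)
  have sl: "\<And>t. (\<lambda>s. u (s,t)) \<in> ZL1 G" "\<And>s. (\<lambda>t. u (s,t)) \<in> ZL1 G"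
    using assms by (simp_all add: ZL1_tensor_iff)
  obtain n a b where "(n, a, b) \<in> tensor_reps (ZL1 G) u"
    and "(\<Sum>i<n. L1_norm G (a i) * L1_norm G (b i)) = l1_norm2 u"
    by (rule class_indicator_representation[OF sl])
  then show "l1_norm2 u \<in> {\<Sum>i<n. L1_norm G (a i) * L1_norm G (b i) | n a b. (n, a, b) \<in> tensor_reps (ZL1 G) u}"
    by (intro CollectI exI[of _ n] exI[of _ a] exI[of _ b]) simp
qed (auto intro: l1_norm2_le_representation)

text \<open>Turns convergence in the projective norm into pointwise convergence; the factor undoes
  the normalisation of the measure.\<close>

lemma cmod_le_l1_norm2:
  assumes "u \<in> ZL1_tensor G"
  shows "cmod (u (s,t)) \<le> (real (card (carrier G)))\<^sup>2 * l1_norm2 u"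
proof (cases "s \<in> carrier G \<and> t \<in> carrier G")
  case True
  have "cmod (u (s,t)) \<le> (\<Sum>t\<in>carrier G. cmod (u (s,t)))"
    using True fin by (intro member_le_sum) auto
  also have "\<dots> \<le> (\<Sum>s\<in>carrier G. \<Sum>t\<in>carrier G. cmod (u (s,t)))"
    using True fin by (intro member_le_sum[of s _ "\<lambda>s. \<Sum>t\<in>carrier G. cmod (u (s,t))"]) (auto intro: sum_nonneg)
  finally show ?thesis using card_pos by (simp add: l1_norm2_def)
next
  case False
  then have "u (s,t) = 0" using assms by (auto simp: ZL1_tensor_iff ZL1_def L1_def)
  moreover have "0 \<le> l1_norm2 u" by (simp add: l1_norm2_def sum_nonneg)
  ultimately show ?thesis by simp
qed

section \<open>Bimodule actions on sums of elementary tensors, and the diagonal\<close>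

lemma lact_sum: "lact G f (\<lambda>p. \<Sum>i\<in>I. u i p) = (\<lambda>p. \<Sum>i\<in>I. lact G f (u i) p)"
  by (auto simp: lact_def conv_sum_right fun_eq_iff)

lemma ract_sum: "ract G (\<lambda>p. \<Sum>i\<in>I. u i p) f = (\<lambda>p. \<Sum>i\<in>I. ract G (u i) f p)"
  by (auto simp: ract_def conv_sum_left fun_eq_iff)

lemma mult_map_sum: "mult_map G (\<lambda>p. \<Sum>i\<in>I. u i p) = (\<lambda>s. \<Sum>i\<in>I. mult_map G (u i) s)"
  by (rule ext) (auto simp: mult_map_def sum_divide_distrib intro: sum.swap)

lemma lact_tensor: "lact G f (tensor a b) = tensor (conv G f a) b"
  by (auto simp: lact_def tensor_def fun_eq_iff conv_cmult_right mult.commute[of _ "b _"])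

lemma ract_tensor: "ract G (tensor a b) f = tensor a (conv G b f)"
  by (auto simp: ract_def tensor_def fun_eq_iff conv_cmult_left)

lemma mult_map_tensor: "mult_map G (tensor a b) = conv G a b"
  by (auto simp: mult_map_def tensor_def conv_def)

lemma tensor_sum_left: "tensor (\<lambda>s. \<Sum>i\<in>I. a i s) b = (\<lambda>p. \<Sum>i\<in>I. tensor (a i) b p)"
  by (auto simp: tensor_def fun_eq_iff sum_distrib_right)

lemma tensor_sum_right: "tensor a (\<lambda>s. \<Sum>i\<in>I. b i s) = (\<lambda>p. \<Sum>i\<in>I. tensor a (b i) p)"
  by (auto simp: tensor_def fun_eq_iff sum_distrib_left)

lemma ract_diff: "ract G (\<lambda>p. u p - v p) f = (\<lambda>p. ract G u f p - ract G v f p)"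
  by (auto simp: ract_def fun_eq_iff conv_diff_left)

definition diag :: "'a \<times> 'a \<Rightarrow> complex" where
  "diag = (\<lambda>p. \<Sum>\<pi>\<in>dual G. tensor (idem \<pi>) (idem \<pi>) p)"

lemma ZL1_tensorE:
  assumes "u \<in> ZL1_tensor G"
  obtains n a b where "\<And>i. i < n \<Longrightarrow> a i \<in> ZL1 G" "\<And>i. i < n \<Longrightarrow> b i \<in> ZL1 G"
    "u = (\<lambda>p. \<Sum>i<(n::nat). tensor (a i) (b i) p)"
  using assms unfolding ZL1_tensor_def tensor_reps_def by blast

lemma L1_unit_L1: "L1_unit G \<in> L1 G"
  by (auto simp: L1_unit_def L1_def)

lemma conv_unit_left: "f \<in> ZL1 G \<Longrightarrow> conv G (L1_unit G) f = f"
  using conv_commute[OF _ L1_unit_L1] conv_unit_right ZL1_L1 by metis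

text \<open>For an elementary tensor a (x) b, let a and b act on e_pi by the scalars k and l. Then
  the pi-term is k l times e_pi (x) e_pi on either side.\<close>

lemma lact_mult_diag:
  assumes "u \<in> ZL1_tensor G"
  shows "lact G (mult_map G u) diag = (\<lambda>p. \<Sum>\<pi>\<in>dual G. ract G (lact G (idem \<pi>) u) (idem \<pi>) p)"
proof -
  obtain n a b where a: "\<And>i. i < n \<Longrightarrow> a i \<in> ZL1 G" and b: "\<And>i. i < n \<Longrightarrow> b i \<in> ZL1 G"
    and u: "u = (\<lambda>p. \<Sum>i<(n::nat). tensor (a i) (b i) p)"
    by (rule ZL1_tensorE[OF assms]) blast
  have "tensor (conv G (conv G (a i) (b i)) (idem \<pi>)) (idem \<pi>) = tensor (conv G (idem \<pi>) (a i)) (conv G (b i) (idem \<pi>))"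
    if i: "i < n" and pi: "\<pi> \<in> dual G" for i \<pi>
  proof -
    obtain k where k: "conv G (a i) (idem \<pi>) = (\<lambda>s. k * idem \<pi> s)" using conv_idem_eigen[OF pi a[OF i]] by blast
    obtain l where l: "conv G (b i) (idem \<pi>) = (\<lambda>s. l * idem \<pi> s)" using conv_idem_eigen[OF pi b[OF i]] by blast
    have "conv G (idem \<pi>) (a i) = (\<lambda>s. k * idem \<pi> s)"
      using conv_commute[OF a[OF i] ZL1_L1[OF idem_ZL1[OF pi]]] k by simp
    moreover have "conv G (conv G (a i) (b i)) (idem \<pi>) = (\<lambda>s. l * (k * idem \<pi> s))"
      by (simp add: conv_assoc l conv_cmult_right k)
    ultimately show ?thesis by (simp add: l tensor_def fun_eq_iff)
  qed
  then have "(\<Sum>\<pi>\<in>dual G. \<Sum>i<n. tensor (conv G (conv G (a i) (b i)) (idem \<pi>)) (idem \<pi>) p)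
     = (\<Sum>\<pi>\<in>dual G. \<Sum>i<n. tensor (conv G (idem \<pi>) (a i)) (conv G (b i) (idem \<pi>)) p)" for p
    by (intro sum.cong) auto
  then show ?thesis
    by (simp add: u diag_def mult_map_sum mult_map_tensor lact_sum lact_tensor ract_sum ract_tensor
        conv_sum_left tensor_sum_left)
qed

text \<open>Acting twice is acting once by idempotence, and the e_pi add up to the unit. The
  redundant second action gives the sum the shape of the one in \<open>lact_mult_diag\<close>, with
  one left action turned into a right action.\<close>

lemma ract_idem_twice:
  assumes "u \<in> ZL1_tensor G"
  shows "(\<lambda>p. \<Sum>\<pi>\<in>dual G. ract G (ract G u (idem \<pi>)) (idem \<pi>) p) = u"
proof -
  obtain n a b where a: "\<And>i. i < n \<Longrightarrow> a i \<in> ZL1 G" and b: "\<And>i. i < n \<Longrightarrow> b i \<in> ZL1 G"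
    and u: "u = (\<lambda>p. \<Sum>i<(n::nat). tensor (a i) (b i) p)"
    by (rule ZL1_tensorE[OF assms]) blast
  have "(\<Sum>\<pi>\<in>dual G. ract G (ract G u (idem \<pi>)) (idem \<pi>) p)
      = (\<Sum>\<pi>\<in>dual G. \<Sum>i<n. tensor (a i) (conv G (b i) (idem \<pi>)) p)" for p
    by (simp add: u ract_sum ract_tensor conv_assoc conv_idem_self)
  also have "\<dots> p = (\<Sum>i<n. \<Sum>\<pi>\<in>dual G. tensor (a i) (conv G (b i) (idem \<pi>)) p)" for p
    by (rule sum.swap)
  also have "\<dots> p = (\<Sum>i<n. tensor (a i) (conv G (b i) (L1_unit G)) p)" for p
    by (simp add: conv_sum_right tensor_sum_right flip: sum_idem)
  also have "\<dots> p = u p" for p using b by (simp add: u conv_unit_right ZL1_L1)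
  finally show ?thesis by simp
qed

lemma diag_tensor: "diag \<in> ZL1_tensor G"
  unfolding ZL1_tensor_iff diag_def tensor_def
proof (intro conjI allI)
  fix t
  have sum: "(\<lambda>s. \<Sum>\<pi>\<in>dual G. idem \<pi> t * idem \<pi> s) \<in> ZL1 G" by (intro ZL1_sum ZL1_cmult idem_ZL1)
  show "(\<lambda>s. \<Sum>\<pi>\<in>dual G. case (s, t) of (s, t) \<Rightarrow> idem \<pi> s * idem \<pi> t) \<in> ZL1 G"
    using sum by (simp add: mult.commute)
  show "(\<lambda>s. \<Sum>\<pi>\<in>dual G. case (t, s) of (s, t) \<Rightarrow> idem \<pi> s * idem \<pi> t) \<in> ZL1 G"
    using sum by simp
qed

lemma diag_is_diagonal: "is_diagonal G diag"
  unfolding is_diagonal_def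
proof (intro conjI ballI)
  fix f assume f: "f \<in> ZL1 G"
  have "tensor (conv G f (idem \<pi>)) (idem \<pi>) = tensor (idem \<pi>) (conv G (idem \<pi>) f)" if pi: "\<pi> \<in> dual G" for \<pi>
  proof -
    obtain k where k: "conv G f (idem \<pi>) = (\<lambda>s. k * idem \<pi> s)" using conv_idem_eigen[OF pi f] by blast
    then have "conv G (idem \<pi>) f = (\<lambda>s. k * idem \<pi> s)"
      using conv_commute[OF f ZL1_L1[OF idem_ZL1[OF pi]]] by simp
    then show ?thesis by (simp add: k tensor_def fun_eq_iff)
  qed
  then show "lact G f diag = ract G diag f"
    by (simp add: diag_def lact_sum ract_sum lact_tensor ract_tensor)
next
  show "mult_map G diag = L1_unit G"
    by (simp add: diag_def mult_map_sum mult_map_tensor conv_idem_self sum_idem)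
qed (rule diag_tensor)

lemma lact_unit_diag: "lact G (L1_unit G) diag = diag"
  by (simp add: diag_def lact_sum lact_tensor conv_unit_left idem_ZL1)

lemma diagonal_unique:
  assumes "is_diagonal G \<nu>"
  shows "\<nu> = diag"
proof -
  have nu: "\<nu> \<in> ZL1_tensor G" "\<And>f. f \<in> ZL1 G \<Longrightarrow> lact G f \<nu> = ract G \<nu> f" "mult_map G \<nu> = L1_unit G"
    using assms by (auto simp: is_diagonal_def)
  have "\<nu> = (\<lambda>p. \<Sum>\<pi>\<in>dual G. ract G (lact G (idem \<pi>) \<nu>) (idem \<pi>) p)"
    using ract_idem_twice[OF nu(1)] by (simp add: nu(2) idem_ZL1)
  also have "\<dots> = diag" using lact_mult_diag[OF nu(1)] by (simp add: nu(3) lact_unit_diag)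
  finally show ?thesis .
qed

text \<open>Required before \<open>proj_norm_eq\<close> can evaluate the norm in the commutator
  condition, since that identity concerns members of \<open>ZL1_tensor G\<close>.\<close>

lemma ZL1_tensor_commutator:
  assumes u: "u \<in> ZL1_tensor G" and f: "f \<in> ZL1 G"
  shows "(\<lambda>p. lact G f u p - ract G u f p) \<in> ZL1_tensor G"
proof -
  obtain n a b where a: "\<And>i. i < n \<Longrightarrow> a i \<in> ZL1 G" and b: "\<And>i. i < n \<Longrightarrow> b i \<in> ZL1 G"
    and u: "u = (\<lambda>p. \<Sum>i<(n::nat). tensor (a i) (b i) p)"
    by (rule ZL1_tensorE[OF u]) blast
  have "(\<lambda>s. \<Sum>i<n. b i t * conv G f (a i) s) \<in> ZL1 G" "(\<lambda>s. \<Sum>i<n. conv G (b i) f t * a i s) \<in> ZL1 G"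
    "(\<lambda>s. \<Sum>i<n. conv G f (a i) t * b i s) \<in> ZL1 G" "(\<lambda>s. \<Sum>i<n. a i t * conv G (b i) f s) \<in> ZL1 G" for t
    using a b f by (auto intro!: ZL1_sum ZL1_cmult ZL1_conv)
  then have *: "(\<lambda>s. \<Sum>i<n. conv G f (a i) s * b i t) \<in> ZL1 G" "(\<lambda>s. \<Sum>i<n. a i s * conv G (b i) f t) \<in> ZL1 G"
    "(\<lambda>s. \<Sum>i<n. conv G f (a i) t * b i s) \<in> ZL1 G" "(\<lambda>s. \<Sum>i<n. a i t * conv G (b i) f s) \<in> ZL1 G" for t
    by (simp_all add: mult.commute)
  show ?thesis
    unfolding ZL1_tensor_iff u lact_sum ract_sum lact_tensor ract_tensor
    unfolding tensor_def using * by (auto intro!: ZL1_diff)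
qed

section \<open>Approximate diagonals and the amenability constant\<close>

lemma tendsto_zero_if_cmod_le:
  fixes w :: "'i \<Rightarrow> complex"
  assumes "(N \<longlongrightarrow> 0) F" "\<And>i. cmod (w i) \<le> K * N i"
  shows "(w \<longlongrightarrow> 0) F"
  by (rule tendsto_norm_zero_cancel,
      rule tendsto_sandwich[OF _ _ tendsto_const tendsto_mult_right_zero[OF assms(1), of K]])
    (simp_all add: assms(2))

text \<open>The difference of \<open>\<mu> i\<close> and m(\<open>\<mu> i\<close>) . mu is a finite
  sum of commutators with the e_pi, each acted on by e_pi, so it tends to 0 pointwise. Moreover
  m(\<open>\<mu> i\<close>) * e_pi tends to e_pi, so m(\<open>\<mu> i\<close>) . mu tends to
  mu.\<close>

lemma approx_diagonal_tendsto:
  assumes "is_bdd_approx_diagonal G \<mu> F"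
  shows "((\<lambda>i. \<mu> i p) \<longlongrightarrow> diag p) F"
proof -
  have T: "\<And>i. \<mu> i \<in> ZL1_tensor G"
    and m: "\<And>f. f \<in> ZL1 G \<Longrightarrow> ((\<lambda>i. L1_norm G (\<lambda>s. conv G (mult_map G (\<mu> i)) f s - f s)) \<longlongrightarrow> 0) F"
    and c: "\<And>f. f \<in> ZL1 G \<Longrightarrow> ((\<lambda>i. proj_norm G (\<lambda>p. lact G f (\<mu> i) p - ract G (\<mu> i) f p)) \<longlongrightarrow> 0) F"
    using assms by (auto simp: is_bdd_approx_diagonal_def)
  have conv_lim: "((\<lambda>i. conv G (mult_map G (\<mu> i)) f s) \<longlongrightarrow> f s) F" if f: "f \<in> ZL1 G" for f s
  proof (rule LIM_zero_cancel, rule tendsto_zero_if_cmod_le[OF m[OF f]])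
    fix i
    let ?d = "\<lambda>s. conv G (mult_map G (\<mu> i)) f s - f s"
    show "cmod (?d s) \<le> real (card (carrier G)) * L1_norm G ?d"
    proof (cases "s \<in> carrier G")
      case True
      then show ?thesis using fin card_pos member_le_sum[of s "carrier G" "\<lambda>s. cmod (?d s)"]
        by (auto simp: L1_norm_def)
    next
      case False
      then have "?d s = 0" using f by (simp add: conv_def ZL1_def L1_def)
      moreover have "0 \<le> L1_norm G ?d" by (simp add: L1_norm_def sum_nonneg)
      ultimately show ?thesis by simp
    qed
  qed
  \<comment> \<open>The commutator is taken with the opposite sign to the definition, as it occurs
    when \<open>lact_mult_diag\<close> is subtracted from \<open>ract_idem_twice\<close>.\<close>
  have comm_lim: "((\<lambda>i. ract G (\<mu> i) f q - lact G f (\<mu> i) q) \<longlongrightarrow> 0) F" if f: "f \<in> ZL1 G" for f q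
  proof (rule tendsto_zero_if_cmod_le[OF c[OF f]])
    fix i
    show "cmod (ract G (\<mu> i) f q - lact G f (\<mu> i) q)
        \<le> (real (card (carrier G)))\<^sup>2 * proj_norm G (\<lambda>p. lact G f (\<mu> i) p - ract G (\<mu> i) f p)"
      using cmod_le_l1_norm2[OF ZL1_tensor_commutator[OF T f], of i "fst q" "snd q"]
      by (simp add: proj_norm_eq[OF ZL1_tensor_commutator[OF T f]] norm_minus_commute)
  qed
  \<comment> \<open>Convolution over a finite group is a finite sum, so one more action by f
    preserves pointwise convergence to 0.\<close>
  have ract_lim: "((\<lambda>i. ract G (\<lambda>q. ract G (\<mu> i) f q - lact G f (\<mu> i) q) f (s,t)) \<longlongrightarrow> 0) F" if f: "f \<in> ZL1 G" for f s t
  proof (cases "t \<in> carrier G")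
    case True
    have "((\<lambda>i. (\<Sum>y\<in>carrier G. (ract G (\<mu> i) f (s,y) - lact G f (\<mu> i) (s,y)) * f (inv y \<otimes> t))
        / of_nat (card (carrier G))) \<longlongrightarrow> (\<Sum>y\<in>carrier G. 0 * f (inv y \<otimes> t)) / of_nat (card (carrier G))) F"
      using card_pos by (intro tendsto_divide tendsto_sum tendsto_mult tendsto_const comm_lim[OF f]) auto
    then show ?thesis using True by (simp add: ract_def[of G "\<lambda>q. _ q - _ q"] conv_def)
  qed (simp add: ract_def[of G "\<lambda>q. _ q - _ q"] conv_def)
  have "((\<lambda>i. \<Sum>\<pi>\<in>dual G. ract G (\<lambda>q. ract G (\<mu> i) (idem \<pi>) q - lact G (idem \<pi>) (\<mu> i) q) (idem \<pi>) p)
      \<longlongrightarrow> (\<Sum>\<pi>\<in>dual G. 0)) F"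
    by (cases p, simp only:) (rule tendsto_sum, rule ract_lim, rule idem_ZL1)
  moreover have "(\<Sum>\<pi>\<in>dual G. ract G (\<lambda>q. ract G (\<mu> i) (idem \<pi>) q - lact G (idem \<pi>) (\<mu> i) q) (idem \<pi>) p)
      = \<mu> i p - lact G (mult_map G (\<mu> i)) diag p" for i
    using fun_cong[OF ract_idem_twice[OF T[of i]], of p]
    by (simp add: ract_diff sum_subtractf lact_mult_diag[OF T])
  ultimately have "((\<lambda>i. \<mu> i p - lact G (mult_map G (\<mu> i)) diag p) \<longlongrightarrow> 0) F" by simp
  moreover have "((\<lambda>i. lact G (mult_map G (\<mu> i)) diag p) \<longlongrightarrow> diag p) F"
    unfolding diag_def lact_sum lact_tensor
    by (cases p) (auto simp: tensor_def intro!: tendsto_sum tendsto_mult conv_lim idem_ZL1)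
  ultimately show ?thesis using tendsto_add by force
qed

text \<open>The constant family at mu attains the value. For any other net the supremum bounds every
  \<open>l1_norm2 (\<mu> i)\<close>, hence also their limit.\<close>

lemma am_ZL1_eq: "am_ZL1 TYPE('i) G = l1_norm2 diag"
  unfolding am_ZL1_def
proof (rule cInf_eq_minimum)
  have zero: "(\<lambda>p. 0) \<in> ZL1_tensor G" by (auto simp: ZL1_tensor_iff ZL1_iff L1_def)
  have pz: "proj_norm G (\<lambda>p. 0) = 0" by (simp add: proj_norm_eq[OF zero] l1_norm2_def)
  have d: "mult_map G diag = L1_unit G" "\<And>f. f \<in> ZL1 G \<Longrightarrow> lact G f diag = ract G diag f"
    using diag_is_diagonal by (auto simp: is_diagonal_def)
  \<comment> \<open>Along this filter, which is proper because types are nonempty, the constant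
    family is an approximate diagonal for an arbitrary index type.\<close>
  have "principal (UNIV :: 'i set) \<noteq> bot" unfolding principal_eq_bot_iff by simp
  then have "is_bdd_approx_diagonal G (\<lambda>i :: 'i. diag) (principal UNIV)"
    by (auto simp: is_bdd_approx_diagonal_def diag_tensor d pz conv_unit_left conv_unit_right ZL1_L1 L1_norm_def)
  moreover have "(SUP i :: 'i. proj_norm G diag) = l1_norm2 diag" by (simp add: proj_norm_eq[OF diag_tensor])
  ultimately show "l1_norm2 diag \<in> {SUP i. proj_norm G (\<mu> i) | (\<mu> :: 'i \<Rightarrow> _) F. is_bdd_approx_diagonal G \<mu> F}"
    by (auto intro!: exI[of _ "\<lambda>i :: 'i. diag"])
next
  fix x assume "x \<in> {SUP i. proj_norm G (\<mu> i) | (\<mu> :: 'i \<Rightarrow> _) F. is_bdd_approx_diagonal G \<mu> F}"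
  then obtain \<mu> :: "'i \<Rightarrow> _" and F where x: "x = (SUP i. proj_norm G (\<mu> i))" and ap: "is_bdd_approx_diagonal G \<mu> F"
    by blast
  have T: "\<mu> i \<in> ZL1_tensor G" for i using ap by (simp add: is_bdd_approx_diagonal_def)
  have F: "F \<noteq> bot" and bdd: "bdd_above (range (\<lambda>i. proj_norm G (\<mu> i)))"
    using ap by (auto simp: is_bdd_approx_diagonal_def)
  \<comment> \<open>The norm is a finite sum of moduli, so it is continuous under pointwise
    convergence.\<close>
  have "((\<lambda>i. l1_norm2 (\<mu> i)) \<longlongrightarrow> l1_norm2 diag) F"
    unfolding l1_norm2_def using card_pos
    by (intro tendsto_divide tendsto_sum tendsto_norm tendsto_const approx_diagonal_tendsto[OF ap]) auto
  moreover have "l1_norm2 (\<mu> i) \<le> x" for i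
    using cSUP_upper[OF UNIV_I bdd, of i] by (simp add: x proj_norm_eq[OF T])
  ultimately show "l1_norm2 diag \<le> x" using F by (intro tendsto_upperbound) auto
qed

section \<open>The norm of the diagonal in terms of characters\<close>

lemma character_eq: "g \<in> carrier G \<Longrightarrow> character \<pi> g = rep_char (irr \<pi>) g"
  by (simp add: character_def irr_def rep_char_def)

lemma l1_norm2_diag:
  "l1_norm2 diag = (\<Sum>C\<in>Conj G. \<Sum>C'\<in>Conj G.
     cmod (\<Sum>\<pi>\<in>dual G. of_nat (dim_of \<pi>) ^ 2 * cnj (character_class \<pi> C) * character_class \<pi> C')
     * real (card C) * real (card C')) / real (card (carrier G)) ^ 2"
proof -
  let ?\<chi> = "\<lambda>\<pi>. rep_char (irr \<pi>)"
  let ?F = "\<lambda>s t. cmod (\<Sum>\<pi>\<in>dual G. of_nat (dim_of \<pi>) ^ 2 * cnj (?\<chi> \<pi> s) * ?\<chi> \<pi> t)"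
  have Z: "?\<chi> \<pi> \<in> ZL1 G" if "\<pi> \<in> dual G" for \<pi>
    using rep_char_ZL1[OF is_irrepD(2)[OF dual_representative(1)[OF that]]] .
  have "(\<Sum>s\<in>carrier G. \<Sum>t\<in>carrier G. cmod (diag (s,t)))
      = (\<Sum>s\<in>carrier G. \<Sum>t\<in>carrier G. cmod (diag (inv s,t)))"
    using sum_inv[of "\<lambda>s. \<Sum>t\<in>carrier G. cmod (diag (s,t))"] by simp
  also have "\<dots> = (\<Sum>s\<in>carrier G. \<Sum>t\<in>carrier G. ?F s t)"
  proof (rule sum.cong[OF refl], rule sum.cong[OF refl])
    fix s t assume s: "s \<in> carrier G"
    have "diag (inv s, t) = (\<Sum>\<pi>\<in>dual G. of_nat (dim_of \<pi>) ^ 2 * cnj (?\<chi> \<pi> s) * ?\<chi> \<pi> t)"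
      unfolding diag_def tensor_def idem_def
      by (rule sum.cong[OF refl])
        (simp add: rep_char_inv[OF is_irrepD(2)[OF dual_representative(1)] s] power2_eq_square)
    then show "cmod (diag (inv s, t)) = ?F s t" by simp
  qed
  \<comment> \<open>The summand is a class function in s and in t separately, so each sum collapses
    to chosen class representatives weighted by class sizes.\<close>
  also have "\<dots> = (\<Sum>C\<in>Conj G. real (card C) * (\<Sum>t\<in>carrier G. ?F (SOME g. g \<in> C) t))"
    by (rule sum_Conj) (simp add: ZL1_conj_class[OF Z] cong: sum.cong)
  also have "\<dots> = (\<Sum>C\<in>Conj G. real (card C) * (\<Sum>C'\<in>Conj G. real (card C') * ?F (SOME g. g \<in> C) (SOME g. g \<in> C')))"
    by (rule sum.cong[OF refl], subst sum_Conj) (simp_all add: ZL1_conj_class[OF Z] cong: sum.cong)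
  also have "\<dots> = (\<Sum>C\<in>Conj G. \<Sum>C'\<in>Conj G.
     cmod (\<Sum>\<pi>\<in>dual G. of_nat (dim_of \<pi>) ^ 2 * cnj (character_class \<pi> C) * character_class \<pi> C')
     * real (card C) * real (card C'))"
    by (simp add: character_class_def character_eq Conj_rep(2) sum_distrib_left ac_simps cong: sum.cong)
  finally show ?thesis by (simp add: l1_norm2_def)
qed

end

theorem theorem1p8:
  fixes G :: "('a, 'b) monoid_scheme"
  assumes "group G" and "finite (carrier G)"
  shows "(\<exists>!\<mu>. is_diagonal G \<mu>)
    \<and> am_ZL1 TYPE('i) G =
        (\<Sum>C\<in>Conj G. \<Sum>C'\<in>Conj G.
           cmod (\<Sum>\<pi>\<in>dual G. of_nat (dim_of \<pi>) ^ 2 * cnj (character_class \<pi> C) * character_class \<pi> C')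
           * real (card C) * real (card C'))
        / real (card (carrier G)) ^ 2"
proof -
  interpret fin_group G using assms by (simp add: fin_group_def fin_group_axioms_def)
  have "\<exists>!\<mu>. is_diagonal G \<mu>" using diag_is_diagonal diagonal_unique by (rule ex1I)
  then show ?thesis unfolding am_ZL1_eq l1_norm2_diag by (rule conjI[OF _ refl])
qed

end
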